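(* Let $n,m\ge 1$ and let $T_m$ be a knot vector as in the context. For $j=0,1,\ldots,n+m$ put $$D_{-n+j,n}^m(t) := \sum_{i=0}^{n+m}\varrho_{j,i}L_{i,n}(t),\qquad \varrho_{j,i} := \langle L_{i,n},L_{i,n}\rangle_L^{-1}\,\psi_{j,i},$$ where $$\psi_{j,i} := \begin{cases} 1 & (i=0),\\ \phi_{j,i} & (i=1,2,\ldots,n),\\ \gamma_{j,i-n} & (i=n+1,n+2,\ldots,n+m-1),\\ \beta_{j,m} & (i=n+m),\end{cases}$$ and $L_{i,n},\phi_{j,i},\gamma_{j,k},\beta_{j,m}$ are defined in the context. Then the functions $D_{-n+j,n}^m$ $(j=0,1,\ldots,n+m)$ form the dual basis for the B-spline basis $N_{-n,n}^m,N_{-n+1,n}^m,\ldots,N_{m,n}^m$ of the space $\Omega_n[T_m]$ with respect to the inner product $\langle\cdot,\cdot\rangle_L$; that is, they span $\Omega_n[T_m]$ and $$\left\langle N_{-n+i,n}^m,\,D_{-n+j,n}^m\right\rangle_L=\delta_{i,j}\qquad (i,j=0,1,\ldots,n+m).$$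
   Context: Knots. Let $n,m\ge 1$ and let $0<t_1\le t_2\le\cdots\le t_m<1$ be such that no value occurs more than $n$ times among $t_1,\ldots,t_m$. For $0\le k\le m$ the knot vector $T_k=(t^{(k)}_{-n},t^{(k)}_{-n+1},\ldots,t^{(k)}_{n+k+1})$ is given by $t^{(k)}_{-n}=\cdots=t^{(k)}_0=0$, $t^{(k)}_i=t_i$ for $1\le i\le k$, and $t^{(k)}_{k+1}=\cdots=t^{(k)}_{n+k+1}=1$. B-splines. The B-splines over $T_k$ are defined by $N_{i,0}^k(t)=1$ if $t^{(k)}_i\le t<t^{(k)}_{i+1}$ and $0$ otherwise, and for degree $d\ge1$ $$N_{i,d}^k(t)=\frac{t-t_i^{(k)}}{t_{i+d}^{(k)}-t_i^{(k)}}N_{i,d-1}^k(t)+\frac{t_{i+d+1}^{(k)}-t}{t_{i+d+1}^{(k)}-t_{i+1}^{(k)}}N_{i+1,d-1}^k(t),$$ for all $i$ with $-n\le i$ and $i+d+1\le n+k+1$, a quotient with zero denominator being $0$. Values at $t=1$ are understood as limits from the left. $\Omega_n[T_k]$ is the space of spline functions on $[0,1]$ of degree at most $n$ over $T_k$; it has basis $N_{-n,n}^k,\ldots,N_{k,n}^k$. The inner product is $\langle f,g\rangle_L=\int_0^1 f(t)g(t)\,dt$, and $\delta_{i,j}$ is the Kronecker delta. $(h)_0=1$, $(h)_l=h(h+1)\cdots(h+l-1)$. Legendre-like orthogonal basis. For $i=0,\ldots,n$: $L_{i,n}(t)=\frac{1}{i!}\frac{d^i}{dt^i}\big[(1-t)^it^i\big]$.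 For $k=1,\ldots,m$: $$L_{n+k,n}(t)=\frac{d^{n+1}}{dt^{n+1}}f_k(t),\qquad f_k(t)=\sum_{j=0}^{k-1}\alpha_{-n+j,k}N_{-n+j,2n+1}^k(t),$$ where the real coefficients $\alpha_{-n+j,k}$ (unique for each $k$ up to a common nonzero factor) are such that $L_{0,n},L_{1,n},\ldots,L_{n+m,n}$ is an orthogonal basis of $\Omega_n[T_m]$ with respect to $\langle\cdot,\cdot\rangle_L$ (a known result of Wei, Guo and Yang). Coefficients. For $j=0,\ldots,n+m$ and $i=1,\ldots,n$, with $A_j=\{-n+j+1,-n+j+2,\ldots,j\}$, $$\phi_{j,i}=\sum_{h=0}^{i}\frac{(-i)_h(i+1)_h}{\binom{n}{h}(h!)^2}\sum_{\substack{S\subset A_j\\|S|=h}}\ \prod_{s\in S}t_s^{(m)}.$$ For $k=1,\ldots,m$ and $j=0,\ldots,k-1$ set $\lambda_{0,0}^{(j,k)}=1$ and $$\lambda_{v,q}^{(j,k)}=\frac{\lambda_{v-1,q}^{(j,k)}-\lambda_{v-1,q-1}^{(j,k)}}{t^{(k)}_{n+j+q-v+2}-t^{(k)}_{-n+j+q}}\qquad(v=1,\ldots,n+1;\ q=0,\ldots,v),$$ where $\lambda_{u,w}^{(j,k)}=0$ if $w<0$ or $w>u$, and a quotient with zero denominator is $0$. For $h=0,\ldots,n+k$, $$\beta_{h,k}=\frac{(2n+1)!}{n!}\sum_{j=0}^{k-1}\alpha_{-n+j,k}\lambda_{n+1,h-j}^{(j,k)}.$$ For $i=0,\ldots,n+m$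 choose any $s_i\in[t^{(m)}_{-n+i},t^{(m)}_{i+1})$ and set $g_i(y)=(y-s_i)_+^0\prod_{r=1}^n\big(y-t^{(m)}_{-n+i+r}\big)$, where $(y-s)_+^0=1$ for $y>s$ and $0$ for $y\le s$. For $k=1,\ldots,m-1$, $$\gamma_{i,k}=\sum_{h=0}^{n+k}\beta_{h,k}\big(t^{(k)}_{h+1}-t^{(k)}_{-n+h}\big)\big[t^{(k)}_{-n+h},t^{(k)}_{-n+h+1},\ldots,t^{(k)}_{h+1}\big]g_i,$$ where $[x_1,\ldots,x_l]g$ denotes the divided difference of $g$ (confluent, i.e. using derivatives, at repeated nodes; derivatives at $y=s_i$ are taken from the left, consistently with $(0)_+^0=0$). *)

theory Defs
  imports "HOL-Analysis.Analysis" "HOL-Library.Function_Algebras"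
begin

text \<open>
  Functions on $[0,1]$ are represented by functions \<^typ>\<open>real \<Rightarrow> real\<close> that vanish outside $[0,1]$,
  so that equality of such functions is equality on $[0,1]$.
\<close>

definition on01 :: "(real \<Rightarrow> real) \<Rightarrow> real \<Rightarrow> real" where
  "on01 f x = (if 0 \<le> x \<and> x \<le> 1 then f x else 0)"

definition fscale :: "real \<Rightarrow> (real \<Rightarrow> real) \<Rightarrow> real \<Rightarrow> real" where
  "fscale c f = (\<lambda>x. c * f x)"

global_interpretation fun_vs: vector_space fscale
  by unfold_locales (auto simp: fscale_def fun_eq_iff algebra_simps)

definition basis_family :: "('i \<Rightarrow> real \<Rightarrow> real) \<Rightarrow> 'i set \<Rightarrow> (real \<Rightarrow> real) set \<Rightarrow> bool" where
  "basis_family B I V \<longleftrightarrow>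
     inj_on B I \<and> \<not> fun_vs.dependent (B ` I) \<and> fun_vs.span (B ` I) = V"

definition inner_L :: "(real \<Rightarrow> real) \<Rightarrow> (real \<Rightarrow> real) \<Rightarrow> real" where
  "inner_L f g = integral {0..1} (\<lambda>x. f x * g x)"

definition orthogonal_basis :: "('i \<Rightarrow> real \<Rightarrow> real) \<Rightarrow> 'i set \<Rightarrow> (real \<Rightarrow> real) set \<Rightarrow> bool" where
  "orthogonal_basis B I V \<longleftrightarrow>
     basis_family B I V \<and> (\<forall>i\<in>I. \<forall>j\<in>I. i \<noteq> j \<longrightarrow> inner_L (B i) (B j) = 0)"


text \<open>
  The knots $t^{(k)}_i$. The knot vector proper consists of the indices $-n \le i \le n+k+1$;
  the values of \<open>knot\<close> at other indices are never used.
\<close>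

definition knot :: "(nat \<Rightarrow> real) \<Rightarrow> nat \<Rightarrow> int \<Rightarrow> real" where
  "knot t k i = (if i \<le> 0 then 0 else if i \<le> int k then t (nat i) else 1)"

primrec bspline_rec :: "(int \<Rightarrow> real) \<Rightarrow> nat \<Rightarrow> int \<Rightarrow> real \<Rightarrow> real" where
  "bspline_rec T 0 i x = (if T i \<le> x \<and> x < T (i + 1) then 1 else 0)"
| "bspline_rec T (Suc d) i x =
     (x - T i) / (T (i + int (Suc d)) - T i) * bspline_rec T d i x
     + (T (i + int (Suc d) + 1) - x) / (T (i + int (Suc d) + 1) - T (i + 1))
         * bspline_rec T d (i + 1) x"

text \<open>The half-open intervals in degree 0 leave out the right end point $1$, hence the left limit.\<close>

definition bspline :: "(nat \<Rightarrow> real) \<Rightarrow> nat \<Rightarrow> nat \<Rightarrow> int \<Rightarrow> real \<Rightarrow> real" where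
  "bspline t k d i x =
     (if x = 1 then Lim (at_left 1) (bspline_rec (knot t k) d i)
      else bspline_rec (knot t k) d i x)"

text \<open>
  Spline functions of degree at most $n$ over $T_k$: piecewise polynomials that are $C^{n-\mu}$ at
  every interior knot of multiplicity $\mu$ (where $\mu \le n$, so that the truncated subtraction is
  harmless) and that take the left limit at $1$.
\<close>

definition spline_space :: "(nat \<Rightarrow> real) \<Rightarrow> nat \<Rightarrow> nat \<Rightarrow> (real \<Rightarrow> real) set" where
  "spline_space t n k = {f.
     (\<forall>x. x \<notin> {0..1} \<longrightarrow> f x = 0) \<and>
     (\<forall>i\<in>{0..int k}. \<exists>p :: real poly. degree p \<le> n \<and>
        (\<forall>x\<in>{knot t k i..<knot t k (i + 1)}. f x = poly p x)) \<and>
     (\<forall>i\<in>{1..k}. let r = n - card {j\<in>{1..k}. t j = t i} in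
        (\<forall>l<r. (deriv ^^ l) f field_differentiable (at (t i))) \<and>
        isCont ((deriv ^^ r) f) (t i)) \<and>
     (f \<longlongrightarrow> f 1) (at_left 1)}"


text \<open>The derivative relative to $[0,1]$, i.e. one-sided at the end points.\<close>

definition deriv01 :: "(real \<Rightarrow> real) \<Rightarrow> real \<Rightarrow> real" where
  "deriv01 g x = vector_derivative g (at x within {0..1})"

definition f_fun :: "nat \<Rightarrow> (nat \<Rightarrow> real) \<Rightarrow> (int \<Rightarrow> nat \<Rightarrow> real) \<Rightarrow> nat \<Rightarrow> real \<Rightarrow> real" where
  "f_fun n t \<alpha> k x =
     (\<Sum>j<k. \<alpha> (- int n + int j) k * bspline t k (2 * n + 1) (- int n + int j) x)"

definition L :: "nat \<Rightarrow> (nat \<Rightarrow> real) \<Rightarrow> (int \<Rightarrow> nat \<Rightarrow> real) \<Rightarrow> nat \<Rightarrow> real \<Rightarrow> real" where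
  "L n t \<alpha> i =
     on01 (if i \<le> n
           then (\<lambda>x. 1 / fact i * (deriv ^^ i) (\<lambda>y. (1 - y) ^ i * y ^ i) x)
           else (deriv01 ^^ (n + 1)) (f_fun n t \<alpha> (i - n)))"


definition phi :: "nat \<Rightarrow> nat \<Rightarrow> (nat \<Rightarrow> real) \<Rightarrow> nat \<Rightarrow> nat \<Rightarrow> real" where
  "phi n m t j i =
     (\<Sum>h\<le>i. pochhammer (- real i) h * pochhammer (real i + 1) h
              / (real (n choose h) * (fact h)\<^sup>2)
            * (\<Sum>S | S \<subseteq> {- int n + int j + 1..int j} \<and> card S = h. \<Prod>s\<in>S. knot t m s))"

fun lam :: "nat \<Rightarrow> (nat \<Rightarrow> real) \<Rightarrow> nat \<Rightarrow> nat \<Rightarrow> nat \<Rightarrow> int \<Rightarrow> real" where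
  "lam n t j k 0 q = (if q = 0 then 1 else 0)"
| "lam n t j k (Suc v) q =
     (if q < 0 \<or> q > int (Suc v) then 0
      else (lam n t j k v q - lam n t j k v (q - 1))
           / (knot t k (int n + int j + q - int (Suc v) + 2) - knot t k (- int n + int j + q)))"

definition beta :: "nat \<Rightarrow> (nat \<Rightarrow> real) \<Rightarrow> (int \<Rightarrow> nat \<Rightarrow> real) \<Rightarrow> nat \<Rightarrow> nat \<Rightarrow> real" where
  "beta n t \<alpha> h k =
     fact (2 * n + 1) / fact n
     * (\<Sum>j<k. \<alpha> (- int n + int j) k * lam n t j k (n + 1) (int h - int j))"

definition left_deriv :: "(real \<Rightarrow> real) \<Rightarrow> real \<Rightarrow> real" where
  "left_deriv g x = vector_derivative g (at_left x)"

text \<open>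
  The divided difference $[T_a, T_{a+1}, \ldots, T_{a+l}]\,g$ of a nondecreasing sequence of nodes.
  Derivatives at repeated nodes are taken from the left; for the functions \<open>g_fun\<close> below this only
  makes a difference at the jump \<open>s i\<close>.
\<close>

fun divdiff :: "(int \<Rightarrow> real) \<Rightarrow> int \<Rightarrow> nat \<Rightarrow> (real \<Rightarrow> real) \<Rightarrow> real" where
  "divdiff T a 0 g = g (T a)"
| "divdiff T a (Suc l) g =
     (if T a = T (a + int (Suc l)) then (left_deriv ^^ Suc l) g (T a) / fact (Suc l)
      else (divdiff T (a + 1) l g - divdiff T a l g) / (T (a + int (Suc l)) - T a))"

definition g_fun :: "nat \<Rightarrow> nat \<Rightarrow> (nat \<Rightarrow> real) \<Rightarrow> (nat \<Rightarrow> real) \<Rightarrow> nat \<Rightarrow> real \<Rightarrow> real" where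
  "g_fun n m t s i y =
     (if y > s i then 1 else 0) * (\<Prod>r=1..n. y - knot t m (- int n + int i + int r))"

definition gamma ::
  "nat \<Rightarrow> nat \<Rightarrow> (nat \<Rightarrow> real) \<Rightarrow> (int \<Rightarrow> nat \<Rightarrow> real) \<Rightarrow> (nat \<Rightarrow> real) \<Rightarrow> nat \<Rightarrow> nat \<Rightarrow> real" where
  "gamma n m t \<alpha> s i k =
     (\<Sum>h\<le>n + k. beta n t \<alpha> h k * (knot t k (int h + 1) - knot t k (- int n + int h))
                 * divdiff (knot t k) (- int n + int h) (n + 1) (g_fun n m t s i))"

definition psi ::
  "nat \<Rightarrow> nat \<Rightarrow> (nat \<Rightarrow> real) \<Rightarrow> (int \<Rightarrow> nat \<Rightarrow> real) \<Rightarrow> (nat \<Rightarrow> real) \<Rightarrow> nat \<Rightarrow> nat \<Rightarrow> real" where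
  "psi n m t \<alpha> s j i =
     (if i = 0 then 1
      else if i \<le> n then phi n m t j i
      else if i < n + m then gamma n m t \<alpha> s j (i - n)
      else beta n t \<alpha> j m)"

definition rho ::
  "nat \<Rightarrow> nat \<Rightarrow> (nat \<Rightarrow> real) \<Rightarrow> (int \<Rightarrow> nat \<Rightarrow> real) \<Rightarrow> (nat \<Rightarrow> real) \<Rightarrow> nat \<Rightarrow> nat \<Rightarrow> real" where
  "rho n m t \<alpha> s j i = inverse (inner_L (L n t \<alpha> i) (L n t \<alpha> i)) * psi n m t \<alpha> s j i"

text \<open>\<open>dual_fun n m t \<alpha> s j\<close> is $D^m_{-n+j,n}$.\<close>

definition dual_fun ::
  "nat \<Rightarrow> nat \<Rightarrow> (nat \<Rightarrow> real) \<Rightarrow> (int \<Rightarrow> nat \<Rightarrow> real) \<Rightarrow> (nat \<Rightarrow> real) \<Rightarrow> nat \<Rightarrow> real \<Rightarrow> real" where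
  "dual_fun n m t \<alpha> s j x = (\<Sum>i\<le>n + m. rho n m t \<alpha> s j i * L n t \<alpha> i x)"

end

theory Submission
  imports Defs
begin

text \<open>
  The numbers \<open>\<psi>\<^sub>j\<^sub>,\<^sub>i\<close> are the B-spline coefficients of the orthogonal basis:
  \<open>L\<^sub>i = \<Sum>\<^sub>j \<psi>\<^sub>j\<^sub>,\<^sub>i N\<^sub>j\<close> away from the knots (\<open>L_eq_sum_psi_bspline\<close>), hence under every integral.
  Everything else is linear algebra. Orthogonality gives
  \<open>\<Sum>\<^sub>j \<psi>\<^sub>j\<^sub>,\<^sub>i\<^sub>' \<langle>N\<^sub>j, L\<^sub>i\<rangle> = \<langle>L\<^sub>i\<^sub>', L\<^sub>i\<rangle>\<close>, which is zero unless \<open>i = i'\<close>, and this turns the definition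
  \<open>D\<^sub>j = \<Sum>\<^sub>i \<psi>\<^sub>j\<^sub>,\<^sub>i L\<^sub>i / \<langle>L\<^sub>i, L\<^sub>i\<rangle>\<close> into the inverse relation \<open>L\<^sub>i = \<Sum>\<^sub>j \<langle>N\<^sub>j, L\<^sub>i\<rangle> D\<^sub>j\<close>.
  So the \<open>D\<^sub>j\<close> span the same space as the equally many \<open>L\<^sub>i\<close> and are a basis
  (\<open>basis_family_change\<close>). Substituting the inverse relation into the definition writes \<open>D\<^sub>j\<close> as
  \<open>\<Sum>\<^sub>h \<langle>N\<^sub>h, D\<^sub>j\<rangle> D\<^sub>h\<close>, and comparing coefficients (\<open>basis_family_coeffs_eq\<close>) gives
  \<open>\<langle>N\<^sub>h, D\<^sub>j\<rangle> = \<delta>\<^sub>h\<^sub>,\<^sub>j\<close>.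
  
  The coefficients of the \<open>L\<^sub>i\<close> come from three classical facts about B-splines.
  \<^item> Marsden's identity \<open>(y - x)\<^sup>n = \<Sum>\<^sub>j (y - t\<^sub>j\<^sub>+\<^sub>1) \<dots> (y - t\<^sub>j\<^sub>+\<^sub>n) N\<^sub>j(x)\<close> (\<open>marsden_identity\<close>) expresses
    the monomials in \<open>x\<close>, hence the shifted Legendre polynomials, through elementary symmetric
    functions of the knots; this yields \<open>\<phi>\<close>.
  \<^item> Differentiating a B-spline gives a difference of two B-splines of lower degree, and \<open>n + 1\<close> such
    steps are recorded by the triangular scheme \<open>\<lambda>\<close>; this yields \<open>\<beta>\<close>, the coefficients of
    \<open>L\<^sub>n\<^sub>+\<^sub>k\<close> over the coarse knots \<open>T\<^sub>k\<close> (\<open>L_eq_sum_beta_bspline\<close>).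
  \<^item> Inserting the remaining knots of \<open>T\<^sub>m\<close> writes each B-spline over \<open>T\<^sub>k\<close> in those over
    \<open>T\<^sub>m\<close>, with divided differences of truncated products as coefficients (\<open>knot_insertion\<close>); this
    turns \<open>\<beta>\<close> into \<open>\<gamma>\<close>.
  
  The last two facts both rest on the representation of a B-spline as a divided difference of the
  truncated power \<open>(y - x)\<^sub>+\<^sup>d\<close> in the variable \<open>y\<close> (\<open>bspline_rec_eq_dd\<close>): differentiation in \<open>x\<close> commutes
  with the divided difference, and knot insertion is the divided difference of the truncated form of
  Marsden's identity.
\<close>

section \<open>Divided differences of Taylor data\<close>

text \<open>
  A confluent divided difference depends on a function only through its Taylor coefficients at the
  nodes: \<open>F j y\<close> stands for the \<open>j\<close>-th derivative at \<open>y\<close>, divided by \<open>j!\<close>. Working with this data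
  directly makes linearity and the product rule purely algebraic, also for truncated functions that
  have one-sided derivatives only.
\<close>

fun dd :: "(int \<Rightarrow> real) \<Rightarrow> int \<Rightarrow> nat \<Rightarrow> (nat \<Rightarrow> real \<Rightarrow> real) \<Rightarrow> real" where
  "dd T a 0 F = F 0 (T a)"
| "dd T a (Suc l) F =
     (if T a = T (a + int (Suc l)) then F (Suc l) (T a)
      else (dd T (a + 1) l F - dd T a l F) / (T (a + int (Suc l)) - T a))"

lemma divdiff_eq_dd: "divdiff T a l g = dd T a l (\<lambda>j y. (left_deriv ^^ j) g y / fact j)"
  by (induction l arbitrary: a) auto

lemma dd_confluent: "T a = T (a + int l) \<Longrightarrow> dd T a l F = F l (T a)"
  by (cases l) auto

text \<open>
  Only Taylor coefficients below the multiplicity of a node enter: the \<open>j\<close>-th one is read at \<open>y\<close> only if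
  \<open>y\<close> occupies \<open>j + 1\<close> consecutive positions.
\<close>

lemma dd_cong:
  assumes "\<And>b j. a \<le> b \<Longrightarrow> b + int j \<le> a + int l \<Longrightarrow> T b = T (b + int j) \<Longrightarrow> F j (T b) = G j (T b)"
  shows "dd T a l F = dd T a l G"
  using assms
proof (induction l arbitrary: a)
  case 0
  show ?case using 0[of a 0] by simp
next
  case (Suc l)
  have "dd T (a + 1) l F = dd T (a + 1) l G" "dd T a l F = dd T a l G"
    by (auto intro!: Suc.IH Suc.prems)
  moreover have "T a = T (a + int (Suc l)) \<Longrightarrow> F (Suc l) (T a) = G (Suc l) (T a)"
    by (rule Suc.prems) auto
  ultimately show ?case by simp
qed

lemma dd_sum: "dd T a l (\<lambda>j y. \<Sum>i\<in>I. c i * F i j y) = (\<Sum>i\<in>I. c i * dd T a l (F i))"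
proof (induction l arbitrary: a)
  case (Suc l)
  then show ?case
    by (simp add: sum_subtractf[symmetric] sum_divide_distrib right_diff_distrib')
qed simp

text \<open>
  The defining quotient, cleared of its denominator so that it also covers confluent nodes, where both
  sides vanish.
\<close>

lemma dd_diff:
  assumes "mono T"
  shows "(T (a + int (Suc l)) - T a) * dd T a (Suc l) F = dd T (a + 1) l F - dd T a l F"
proof (cases "T a = T (a + int (Suc l))")
  case True
  have "T a \<le> T (a + 1)" "T (a + 1) \<le> T (a + 1 + int l)" "T a \<le> T (a + int l)"
    "T (a + int l) \<le> T (a + int (Suc l))"
    by (auto intro!: monoD[OF assms])
  with True have "T a = T (a + int l)" "T (a + 1) = T (a + 1 + int l)" "T a = T (a + 1)"
    by (auto simp: algebra_simps)
  with True show ?thesis by (simp add: dd_confluent del: dd.simps)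
next
  case False
  then show ?thesis by simp
qed

text \<open>
  Leibniz' rule for the product with \<open>y - x\<close>: \<open>F\<close> is the Taylor data of \<open>(y - x) G(y)\<close>, and the
  divided differences of order at least two of the linear factor vanish, which leaves two terms.
\<close>

lemma dd_mult_linear:
  assumes T: "mono T"
    and F: "\<And>j y. F j y = (y - x) * G j y + (if j = 0 then 0 else G (j - 1) y)"
  shows "dd T a (Suc l) F = (T a - x) * dd T a (Suc l) G + dd T (a + 1) l G"
proof (induction l arbitrary: a)
  case 0
  show ?case
  proof (cases "T a = T (a + 1)")
    case False
    then have "T (a + 1) - T a \<noteq> 0" by simp
    with False show ?thesis by (simp add: F divide_simps) (simp add: algebra_simps)
  qed (simp add: F)
next
  case (Suc l)
  let ?b = "T (a + int (Suc (Suc l)))"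
  show ?case
  proof (cases "T a = ?b")
    case True
    have "T a \<le> T (a + 1)" "T (a + 1) \<le> ?b" by (auto intro!: monoD[OF T])
    with True have "T (a + 1) = T (a + 1 + int (Suc l))" "T a = T (a + 1)"
      by (auto simp: algebra_simps)
    with True show ?thesis by (simp add: dd_confluent F del: dd.simps(2))
  next
    case False
    have "(?b - T a) * dd T a (Suc (Suc l)) F = dd T (a + 1) (Suc l) F - dd T a (Suc l) F"
      by (rule dd_diff[OF T])
    also have "dd T (a + 1) (Suc l) F
        = (T (a + 1) - x) * dd T (a + 1) (Suc l) G + dd T (a + 1 + 1) l G"
      by (rule Suc.IH)
    \<comment> \<open>The mirrored form of the rule, with the last node in place of the first; only then do
      the lower-order terms of the two induction hypotheses cancel.\<close>
    also have "\<dots> = (?b - x) * dd T (a + 1) (Suc l) G + dd T (a + 1) l G"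
      using dd_diff[OF T, of "a + 1" l G] by (simp add: algebra_simps del: dd.simps)
    also have "dd T a (Suc l) F = (T a - x) * dd T a (Suc l) G + dd T (a + 1) l G"
      by (rule Suc.IH)
    finally have "(?b - T a) * dd T a (Suc (Suc l)) F
        = (T a - x) * (dd T (a + 1) (Suc l) G - dd T a (Suc l) G)
          + (?b - T a) * dd T (a + 1) (Suc l) G"
      by (simp add: algebra_simps del: dd.simps)
    also have "\<dots> = (?b - T a) * ((T a - x) * dd T a (Suc (Suc l)) G + dd T (a + 1) (Suc l) G)"
      unfolding dd_diff[OF T, of a "Suc l" G, symmetric]
      by (simp add: algebra_simps del: dd.simps)
    finally show ?thesis using False by (simp del: dd.simps)
  qed
qed

lemma dd_has_derivative:
  assumes "\<And>j b. a \<le> b \<Longrightarrow> b \<le> a + int l \<Longrightarrow>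
             ((\<lambda>x. F x j (T b)) has_real_derivative F' j (T b)) (at x)"
  shows "((\<lambda>x. dd T a l (F x)) has_real_derivative dd T a l F') (at x)"
  using assms
proof (induction l arbitrary: a)
  case (Suc l)
  show ?case
  proof (cases "T a = T (a + int (Suc l))")
    case True
    have "((\<lambda>x. F x (Suc l) (T a)) has_real_derivative F' (Suc l) (T a)) (at x)"
      by (rule Suc.prems) auto
    with True show ?thesis by simp
  next
    case False
    have "((\<lambda>x. dd T (a + 1) l (F x)) has_real_derivative dd T (a + 1) l F') (at x)"
      "((\<lambda>x. dd T a l (F x)) has_real_derivative dd T a l F') (at x)"
      by (auto intro!: Suc.IH Suc.prems)
    with False show ?thesis by (auto intro!: DERIV_cdivide DERIV_diff)
  qed
qed auto


section \<open>B-splines as divided differences of truncated powers\<close>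

text \<open>
  The \<open>j\<close>-th Taylor coefficient at \<open>y\<close> of \<open>y \<mapsto> (y - x)\<^sub>+\<^sup>d\<close>. At the breakpoint \<open>y = x\<close> it is zero, which
  matches the half-open intervals in the definition of the B-splines.
\<close>

definition trunc_pow :: "nat \<Rightarrow> real \<Rightarrow> nat \<Rightarrow> real \<Rightarrow> real" where
  "trunc_pow d x j y = (if x < y then real (d choose j) * (y - x) ^ (d - j) else 0)"

lemma trunc_pow_Suc:
  "trunc_pow (Suc d) x j y = (y - x) * trunc_pow d x j y + (if j = 0 then 0 else trunc_pow d x (j - 1) y)"
proof (cases j)
  case (Suc i)
  show ?thesis
  proof (cases "i < d")
    case True
    then have "(y - x) * (y - x) ^ (d - Suc i) = (y - x) ^ (d - i)"
      by (metis Suc_diff_Suc power_Suc)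
    then show ?thesis using Suc
      by (simp add: trunc_pow_def mult.left_commute[of "y - x"] distrib_left distrib_right)
  next
    case False
    then show ?thesis using Suc by (auto simp: trunc_pow_def)
  qed
qed (auto simp: trunc_pow_def)

text \<open>
  The recurrence of the B-splines is Leibniz' rule applied to
  \<open>(y - x)\<^sub>+\<^sup>d\<^sup>+\<^sup>1 = (y - x) (y - x)\<^sub>+\<^sup>d\<close>.
\<close>

lemma bspline_rec_eq_dd:
  assumes T: "mono T"
  shows "bspline_rec T d i x = (T (i + int d + 1) - T i) * dd T i (Suc d) (trunc_pow d x)"
proof (induction d arbitrary: i)
  case 0
  have "T i \<le> T (i + 1)" by (rule monoD[OF T]) simp
  have "(T (i + 1) - T i) * dd T i (Suc 0) (trunc_pow 0 x) = trunc_pow 0 x 0 (T (i + 1)) - trunc_pow 0 x 0 (T i)"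
    using dd_diff[OF T, of i 0 "trunc_pow 0 x"] by simp
  moreover have "bspline_rec T 0 i x = trunc_pow 0 x 0 (T (i + 1)) - trunc_pow 0 x 0 (T i)"
    using \<open>T i \<le> T (i + 1)\<close> by (auto simp: trunc_pow_def)
  ultimately show ?case by (simp del: dd.simps(2) bspline_rec.simps)
next
  case (Suc d)
  let ?G = "trunc_pow d x" and ?b = "T (i + int (Suc d) + 1)"
  have q: "bspline_rec T d i x / (T (i + int (Suc d)) - T i) = dd T i (Suc d) ?G" for i
  proof (cases "T i = T (i + int (Suc d))")
    case True
    then show ?thesis by (simp add: dd_confluent trunc_pow_def)
  next
    case False
    then show ?thesis by (simp add: Suc.IH ac_simps del: dd.simps)
  qed
  have "(?b - T i) * dd T i (Suc (Suc d)) (trunc_pow (Suc d) x)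
      = (T i - x) * ((?b - T i) * dd T i (Suc (Suc d)) ?G) + (?b - T i) * dd T (i + 1) (Suc d) ?G"
    by (simp add: dd_mult_linear[OF T, OF trunc_pow_Suc] algebra_simps del: dd.simps)
  also have "(?b - T i) * dd T i (Suc (Suc d)) ?G = dd T (i + 1) (Suc d) ?G - dd T i (Suc d) ?G"
    using dd_diff[OF T, of i "Suc d" ?G] by (simp add: algebra_simps del: dd.simps)
  finally have "(?b - T i) * dd T i (Suc (Suc d)) (trunc_pow (Suc d) x)
      = (x - T i) * dd T i (Suc d) ?G + (?b - x) * dd T (i + 1) (Suc d) ?G"
    by (simp add: algebra_simps del: dd.simps)
  also have "\<dots> = bspline_rec T (Suc d) i x"
    by (simp add: q[symmetric] ac_simps del: dd.simps)
  finally show ?case by (simp del: dd.simps bspline_rec.simps)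
qed

text \<open>
  With coinciding end knots both sides are zero, because a truncated power of degree \<open>d\<close> has no Taylor
  coefficient of order \<open>d + 1\<close>; this is what the convention on zero denominators amounts to.
\<close>

lemma bspline_rec_quotient:
  assumes T: "mono T"
  shows "bspline_rec T d i x / (T (i + int (Suc d)) - T i) = dd T i (Suc d) (trunc_pow d x)"
proof (cases "T i = T (i + int (Suc d))")
  case True
  then show ?thesis by (simp add: dd_confluent trunc_pow_def)
next
  case False
  then show ?thesis by (simp add: bspline_rec_eq_dd[OF T] ac_simps del: dd.simps)
qed

text \<open>
  Differentiation with respect to the breakpoint \<open>x\<close>, with the node \<open>y\<close> fixed.
\<close>

lemma trunc_pow_has_derivative:
  assumes "y \<noteq> x"
  shows "((\<lambda>x. trunc_pow (Suc d) x j y) has_real_derivative - real (Suc d) * trunc_pow d x j y) (at x)"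
proof (cases "x < y")
  case True
  have c: "real (Suc d choose j) * real (Suc d - j) = real (Suc d) * real (d choose j)"
    if "j \<le> d"
    using that binomial_absorb_comp[of "Suc d" j]
    by (metis diff_Suc_1 mult.commute of_nat_mult)
  have "((\<lambda>x. real (Suc d choose j) * (y - x) ^ (Suc d - j)) has_real_derivative
      real (Suc d choose j) * (real (Suc d - j) * (0 - 1) * (y - x) ^ (Suc d - j - Suc 0))) (at x)"
    by (intro DERIV_cmult) (rule derivative_eq_intros refl | simp)+
  also have "real (Suc d choose j) * (real (Suc d - j) * (0 - 1) * (y - x) ^ (Suc d - j - Suc 0))
      = - real (Suc d) * trunc_pow d x j y"
  proof (cases "j \<le> d")
    case j: True
    then have "Suc d - j - Suc 0 = d - j" by simp
    with c[OF j] True show ?thesis by (simp add: trunc_pow_def del: binomial_Suc_Suc of_nat_Suc)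
  next
    case False
    with True show ?thesis by (simp add: trunc_pow_def)
  qed
  finally have "((\<lambda>x. real (Suc d choose j) * (y - x) ^ (Suc d - j)) has_real_derivative
      - real (Suc d) * trunc_pow d x j y) (at x)" .
  moreover have "\<forall>\<^sub>F z in nhds x. z < y"
    using True by (rule order_tendstoD(2)[OF filterlim_ident])
  then have "\<forall>\<^sub>F z in nhds x. trunc_pow (Suc d) z j y = real (Suc d choose j) * (y - z) ^ (Suc d - j)"
    by eventually_elim (simp add: trunc_pow_def)
  ultimately show ?thesis by (simp add: DERIV_cong_ev)
next
  case False
  then have "y < x" using assms by simp
  then have "\<forall>\<^sub>F z in nhds x. y < z"
    by (rule order_tendstoD(1)[OF filterlim_ident])
  then have "\<forall>\<^sub>F z in nhds x. trunc_pow (Suc d) z j y = 0"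
    by eventually_elim (simp add: trunc_pow_def)
  then have "((\<lambda>x. trunc_pow (Suc d) x j y) has_real_derivative 0) (at x)"
    by (simp add: DERIV_cong_ev)
  then show ?thesis using False by (simp add: trunc_pow_def)
qed

text \<open>
  Differentiating the divided difference of \<open>(y - x)\<^sub>+\<^sup>d\<^sup>+\<^sup>1\<close> under the difference operator lowers the power to
  \<open>d\<close>, while the order \<open>d + 2\<close> stays; the factor \<open>t\<^sub>i\<^sub>+\<^sub>d\<^sub>+\<^sub>2 - t\<^sub>i\<close> in front then splits it into two divided
  differences of order \<open>d + 1\<close>, that is, two B-splines of degree \<open>d\<close>.
\<close>

lemma bspline_rec_has_derivative:
  assumes T: "mono T" and "\<And>b. T b \<noteq> x"
  shows "(bspline_rec T (Suc d) i has_real_derivative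
           real (Suc d) * (bspline_rec T d i x / (T (i + int (Suc d)) - T i)
             - bspline_rec T d (i + 1) x / (T (i + 1 + int (Suc d)) - T (i + 1)))) (at x)"
proof -
  let ?b = "T (i + int (Suc d) + 1)"
  have "((\<lambda>x. (?b - T i) * dd T i (Suc (Suc d)) (trunc_pow (Suc d) x)) has_real_derivative
      (?b - T i) * dd T i (Suc (Suc d)) (\<lambda>j y. - real (Suc d) * trunc_pow d x j y)) (at x)"
    by (intro DERIV_cmult dd_has_derivative trunc_pow_has_derivative assms)
  also have "(\<lambda>x. (?b - T i) * dd T i (Suc (Suc d)) (trunc_pow (Suc d) x)) = bspline_rec T (Suc d) i"
    by (rule ext) (simp only: bspline_rec_eq_dd[OF T])
  also have "dd T i (Suc (Suc d)) (\<lambda>j y. - real (Suc d) * trunc_pow d x j y)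
      = - real (Suc d) * dd T i (Suc (Suc d)) (trunc_pow d x)"
    using dd_sum[of T i "Suc (Suc d)" "\<lambda>_. - real (Suc d)" "\<lambda>_. trunc_pow d x" "{()}"]
    by (simp del: dd.simps)
  also have "(?b - T i) * (- real (Suc d) * dd T i (Suc (Suc d)) (trunc_pow d x))
     = - real (Suc d) * ((T (i + int (Suc (Suc d))) - T i) * dd T i (Suc (Suc d)) (trunc_pow d x))"
    by (simp add: algebra_simps del: dd.simps)
  also have "\<dots> = real (Suc d) * (dd T i (Suc d) (trunc_pow d x) - dd T (i + 1) (Suc d) (trunc_pow d x))"
    unfolding dd_diff[OF T] by (simp add: algebra_simps del: dd.simps)
  finally show ?thesis unfolding bspline_rec_quotient[OF T] .
qed

lemma bspline_rec_support:
  assumes "mono T" and "bspline_rec T d i x \<noteq> 0"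
  shows "T i \<le> x \<and> x < T (i + int d + 1)"
  using assms(2)
proof (induction d arbitrary: i)
  case 0
  then show ?case by (auto split: if_splits)
next
  case (Suc d)
  then have "bspline_rec T d i x \<noteq> 0 \<or> bspline_rec T d (i + 1) x \<noteq> 0" by auto
  then consider "bspline_rec T d i x \<noteq> 0" | "bspline_rec T d (i + 1) x \<noteq> 0" by blast
  then show ?case
  proof cases
    case 1
    moreover have "T (i + int d + 1) \<le> T (i + int (Suc d) + 1)" by (rule monoD[OF assms(1)]) simp
    ultimately show ?thesis using Suc.IH[of i] by simp
  next
    case 2
    moreover have "T i \<le> T (i + 1)" by (rule monoD[OF assms(1)]) simp
    ultimately show ?thesis using Suc.IH[of "i + 1"] by (simp add: algebra_simps)
  qed
qed


section \<open>Marsden's identity\<close>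

text \<open>
  The dual polynomial \<open>(y - t\<^sub>i\<^sub>+\<^sub>1) \<dots> (y - t\<^sub>i\<^sub>+\<^sub>d)\<close> of Marsden's identity, as a polynomial in \<open>y\<close>.
\<close>

definition marsden_poly :: "(int \<Rightarrow> real) \<Rightarrow> nat \<Rightarrow> int \<Rightarrow> real poly" where
  "marsden_poly T d i = (\<Prod>r\<in>{i + 1..i + int d}. [:- T r, 1:])"

lemma marsden_poly_Suc:
  "marsden_poly T (Suc d) i = marsden_poly T d i * [:- T (i + int (Suc d)), 1:]"
  "marsden_poly T (Suc d) (i - 1) = marsden_poly T d i * [:- T i, 1:]"
proof -
  have "{i + 1..i + int (Suc d)} = insert (i + int (Suc d)) {i + 1..i + int d}"
    "{i - 1 + 1..i - 1 + int (Suc d)} = insert i {i + 1..i + int d}" by auto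
  then show "marsden_poly T (Suc d) i = marsden_poly T d i * [:- T (i + int (Suc d)), 1:]"
    "marsden_poly T (Suc d) (i - 1) = marsden_poly T d i * [:- T i, 1:]"
    unfolding marsden_poly_def by simp_all
qed

lemma knot_interval_exists:
  assumes "T 0 \<le> x" "x < T (int k + 1)"
  shows "\<exists>i\<in>{0..int k}. T i \<le> (x :: real) \<and> x < T (i + 1)"
  using assms(2)
proof (induction k)
  case 0
  then show ?case using assms(1) by auto
next
  case (Suc k)
  show ?case
  proof (cases "x < T (int k + 1)")
    case True
    then obtain i where "i \<in> {0..int k}" "T i \<le> x" "x < T (i + 1)" using Suc.IH by blast
    then show ?thesis by (intro bexI[of _ i]) auto
  next
    case False
    then show ?thesis using Suc.prems by (intro bexI[of _ "int k + 1"]) (auto simp: algebra_simps)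
  qed
qed

lemma knot_interval_unique:
  fixes T :: "int \<Rightarrow> real"
  assumes T: "mono T" and "T i \<le> x" "x < T (i + 1)" "T j \<le> x" "x < T (j + 1)"
  shows "i = j"
proof (rule linorder_cases[of i j])
  assume "i < j"
  then have "T (i + 1) \<le> T j" by (intro monoD[OF T]) simp
  with assms show ?thesis by linarith
next
  assume "j < i"
  then have "T (j + 1) \<le> T i" by (intro monoD[OF T]) simp
  with assms show ?thesis by linarith
qed

text \<open>
  Induction on the degree. Inserting the recurrence and collecting the terms with the same B-spline of
  degree \<open>d\<close> leaves the identity
  \<open>(x - t\<^sub>i) (y - t\<^sub>i\<^sub>+\<^sub>d\<^sub>+\<^sub>1) + (t\<^sub>i\<^sub>+\<^sub>d\<^sub>+\<^sub>1 - x) (y - t\<^sub>i) = (t\<^sub>i\<^sub>+\<^sub>d\<^sub>+\<^sub>1 - t\<^sub>i) (y - x)\<close>.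
\<close>

theorem marsden_identity:
  assumes T: "mono T" and x: "T 0 \<le> x" "x < T (int k + 1)"
  shows "(\<Sum>i\<in>{- int d..int k}. smult (bspline_rec T d i x) (marsden_poly T d i)) = [:- x, 1:] ^ d"
proof (induction d)
  case 0
  obtain i where i: "i \<in> {0..int k}" "T i \<le> x" "x < T (i + 1)"
    using knot_interval_exists[of T, OF x] by blast
  have "bspline_rec T 0 i' x = (if i' = i then 1 else 0)" for i'
  proof (cases "i' = i")
    case False
    then have "\<not> (T i' \<le> x \<and> x < T (i' + 1))"
      using knot_interval_unique[OF T, of i' x i] i by blast
    with False show ?thesis by (simp only: bspline_rec.simps if_False)
  qed (use i in simp)
  then have "(\<Sum>i'\<in>{0..int k}. bspline_rec T 0 i' x) = (\<Sum>i'\<in>{0..int k}. if i' = i then 1 else 0)"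
    by (simp only:)
  also have "\<dots> = 1" using i(1) by simp
  finally have "smult (\<Sum>i\<in>{- int 0..int k}. bspline_rec T 0 i x) 1 = 1" by simp
  then show ?case unfolding smult_sum by (simp add: marsden_poly_def del: bspline_rec.simps)
next
  case (Suc d)
  let ?N = "\<lambda>i. bspline_rec T d i x" and ?P = "marsden_poly T"
  define u where "u i = ?N i / (T (i + int (Suc d)) - T i)" for i
  have u: "u i * (T (i + int (Suc d)) - T i) = ?N i" for i
    using bspline_rec_support[OF T, of d i x] by (cases "?N i = 0") (auto simp: u_def ac_simps)
  \<comment> \<open>The two B-splines of degree d that enter at the ends of the index range are supported to
    the left of T 0 and to the right of T (k + 1).\<close>
  have "u (- int (Suc d)) = 0"
    using bspline_rec_support[OF T, of d "- int (Suc d)" x] x(1) by (auto simp: u_def)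
  have "u (int k + 1) = 0"
    using bspline_rec_support[OF T, of d "int k + 1" x] x(2) by (auto simp: u_def)
  have N: "bspline_rec T (Suc d) i x = (x - T i) * u i + (T (i + int (Suc d) + 1) - x) * u (i + 1)" for i
    by (simp add: u_def ac_simps)
  have "(\<Sum>i\<in>{- int (Suc d)..int k}. smult (bspline_rec T (Suc d) i x) (?P (Suc d) i))
      = (\<Sum>i\<in>{- int (Suc d)..int k}. smult ((x - T i) * u i) (?P (Suc d) i))
        + (\<Sum>i\<in>{- int (Suc d)..int k}. smult ((T (i + 1 + int (Suc d)) - x) * u (i + 1)) (?P (Suc d) (i + 1 - 1)))"
    unfolding N by (simp add: sum.distrib[symmetric] smult_add_left ac_simps)
  also have "(\<Sum>i\<in>{- int (Suc d)..int k}. smult ((T (i + 1 + int (Suc d)) - x) * u (i + 1)) (?P (Suc d) (i + 1 - 1)))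
      = (\<Sum>i\<in>{- int d..int k + 1}. smult ((T (i + int (Suc d)) - x) * u i) (?P (Suc d) (i - 1)))"
    by (rule sum.reindex_bij_witness[of _ "\<lambda>i. i - 1" "\<lambda>i. i + 1"]) auto
  also have "\<dots> = (\<Sum>i\<in>{- int d..int k}. smult ((T (i + int (Suc d)) - x) * u i) (?P (Suc d) (i - 1)))"
    using \<open>u (int k + 1) = 0\<close> by (intro sum.mono_neutral_right) (auto simp: not_le dest!: zless_imp_add1_zle)
  also have "(\<Sum>i\<in>{- int (Suc d)..int k}. smult ((x - T i) * u i) (?P (Suc d) i))
      = (\<Sum>i\<in>{- int d..int k}. smult ((x - T i) * u i) (?P (Suc d) i))"
  proof (rule sum.mono_neutral_right)
    have "i = - int (Suc d)" if "i \<in> {- int (Suc d)..int k} - {- int d..int k}" for i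
      using that by auto
    then show "\<forall>i\<in>{- int (Suc d)..int k} - {- int d..int k}. smult ((x - T i) * u i) (?P (Suc d) i) = 0"
      using \<open>u (- int (Suc d)) = 0\<close> by fastforce
  qed auto
  also have "\<dots> + (\<Sum>i\<in>{- int d..int k}. smult ((T (i + int (Suc d)) - x) * u i) (?P (Suc d) (i - 1)))
      = (\<Sum>i\<in>{- int d..int k}. smult (?N i) (?P d i) * [:- x, 1:])"
  proof (subst sum.distrib[symmetric], rule sum.cong[OF refl])
    fix i
    have "smult ((x - T i) * u i) [:- T (i + int (Suc d)), 1:]
        + smult ((T (i + int (Suc d)) - x) * u i) [:- T i, 1:] = smult (?N i) [:- x, 1:]"
      unfolding u[of i, symmetric] by (simp add: algebra_simps del: of_nat_Suc)
    then have "?P d i * (smult ((x - T i) * u i) [:- T (i + int (Suc d)), 1:]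
        + smult ((T (i + int (Suc d)) - x) * u i) [:- T i, 1:]) = ?P d i * smult (?N i) [:- x, 1:]"
      by (rule arg_cong)
    then show "smult ((x - T i) * u i) (?P (Suc d) i)
        + smult ((T (i + int (Suc d)) - x) * u i) (?P (Suc d) (i - 1)) = smult (?N i) (?P d i) * [:- x, 1:]"
      unfolding marsden_poly_Suc(1)[of T d i] marsden_poly_Suc(2)
      by (simp only: distrib_left mult_smult_left mult_smult_right)
  qed
  also have "\<dots> = [:- x, 1:] ^ Suc d"
    by (simp only: sum_distrib_right[symmetric] Suc.IH power_Suc2)
  finally show ?case .
qed


section \<open>Knot insertion\<close>

text \<open>
  Shifting the variable by \<open>y\<close> makes the coefficient linear and multiplicative arguments available
  without derivatives.
\<close>

definition taylor_coeff :: "real poly \<Rightarrow> nat \<Rightarrow> real \<Rightarrow> real" where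
  "taylor_coeff p j y = coeff (pcompose p [:y, 1:]) j"

lemma taylor_coeff_eq_deriv: "taylor_coeff p j y = poly ((pderiv ^^ j) p) y / fact j"
proof (induction j arbitrary: p)
  case 0
  show ?case by (simp add: taylor_coeff_def)
next
  case (Suc j)
  have "pderiv (pcompose p [:y, 1:]) = pcompose (pderiv p) [:y, 1:]"
    by (simp add: pderiv_pcompose pderiv_pCons)
  then have "real (Suc j) * taylor_coeff p (Suc j) y = taylor_coeff (pderiv p) j y"
    unfolding taylor_coeff_def by (metis coeff_pderiv)
  then show ?case
    unfolding Suc.IH funpow_Suc_right o_apply fact_Suc by (simp add: nonzero_eq_divide_eq ac_simps)
qed

lemma taylor_coeff_linear_power:
  "taylor_coeff ([:- x, 1:] ^ d) j y = real (d choose j) * (y - x) ^ (d - j)"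
proof -
  have "pcompose ([:- x, 1:] ^ d) [:y, 1:] = [:y - x, 1:] ^ d"
    by (induction d)
      (simp_all add: pcompose_1 pcompose_mult pcompose_pCons del: mult_pCons_left)
  then show ?thesis
  proof (cases "j \<le> d")
    case True
    then show ?thesis using \<open>pcompose _ _ = _\<close>
      by (simp add: taylor_coeff_def coeff_linear_poly_power)
  next
    case False
    have "degree ([:y - x, 1:] ^ d) \<le> d" using degree_power_le[of "[:y - x, 1:]" d] by simp
    with False show ?thesis using \<open>pcompose _ _ = _\<close>
      by (simp add: taylor_coeff_def coeff_eq_0)
  qed
qed

text \<open>
  If \<open>y\<close> occurs \<open>j + 1\<close> times among the inner knots, then \<open>(Y - y)\<^sup>j\<^sup>+\<^sup>1\<close> divides the dual polynomial.
\<close>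

lemma taylor_coeff_marsden_poly_eq_0:
  assumes T: "mono T" and "i < c" "c + int j \<le> i + int d" "T c = y" "T (c + int j) = y"
  shows "taylor_coeff (marsden_poly T d i) j y = 0"
proof -
  have "pcompose (marsden_poly T d i) [:y, 1:] = (\<Prod>r\<in>{i + 1..i + int d}. [:y - T r, 1:])"
    by (simp add: marsden_poly_def pcompose_prod pcompose_pCons)
  also have "\<dots> = (\<Prod>r\<in>{i + 1..i + int d} - {c..c + int j}. [:y - T r, 1:])
      * (\<Prod>r\<in>{c..c + int j}. [:y - T r, 1:])"
    by (rule prod.subset_diff) (use assms in auto)
  also have "(\<Prod>r\<in>{c..c + int j}. [:y - T r, 1:]) = (\<Prod>r\<in>{c..c + int j}. [:0, 1:])"
  proof (rule prod.cong[OF refl])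
    fix r assume "r \<in> {c..c + int j}"
    then have "T c \<le> T r" "T r \<le> T (c + int j)" by (auto intro!: monoD[OF T])
    with assms(4,5) show "[:y - T r, 1:] = [:0, 1:]" by simp
  qed
  also have "\<dots> = monom 1 (Suc j)" by (simp add: monom_altdef nat_add_distrib)
  finally show ?thesis by (simp add: taylor_coeff_def coeff_monom_mult mult.commute[of _ "monom _ _"])
qed

text \<open>
  The representation of a coarse B-spline in the fine ones. Here \<open>T\<close> are the coarse and \<open>\<tau>\<close> the fine
  knots; assumption \<open>refines\<close> says that a coarse knot strictly between two fine knots is a fine knot of
  at least the same multiplicity. At the nodes \<open>T\<close>, up to the order given by the multiplicities, the
  Taylor data of \<open>y \<mapsto> (y - x)\<^sub>+\<^sup>n\<close> agrees with that of
  \<open>\<Sum>\<^sub>i N\<^sub>i(x) (y - s\<^sub>i)\<^sub>+\<^sup>0 (y - \<tau>\<^sub>i\<^sub>+\<^sub>1) \<dots> (y - \<tau>\<^sub>i\<^sub>+\<^sub>n)\<close>. Untruncated this is Marsden's identity.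
  Where \<open>N\<^sub>i(x) \<noteq> 0\<close>, truncating at \<open>s\<^sub>i\<close> instead of \<open>x\<close> can only matter at nodes between the two, which lie in
  the interior of the support of \<open>N\<^sub>i\<close>; there the product vanishes to the order that is read.
\<close>

theorem knot_insertion:
  assumes T: "mono T" and \<tau>: "mono \<tau>"
    and refines: "\<And>b j a e. T b = T (b + int j) \<Longrightarrow> \<tau> a < T b \<Longrightarrow> T b < \<tau> e \<Longrightarrow>
                    \<exists>c. \<tau> c = T b \<and> \<tau> (c + int j) = T b"
    and x: "\<tau> 0 \<le> x" "x < \<tau> (int k + 1)"
    and s: "\<And>i. i \<in> {- int n..int k} \<Longrightarrow> \<tau> i \<le> s i \<and> s i < \<tau> (i + int n + 1)"
  shows "bspline_rec T n h x =
    (\<Sum>i\<in>{- int n..int k}. (T (h + int n + 1) - T h)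
       * dd T h (Suc n) (\<lambda>j y. if s i < y then taylor_coeff (marsden_poly \<tau> n i) j y else 0)
       * bspline_rec \<tau> n i x)"
proof -
  let ?G = "\<lambda>i j y. if s i < y then taylor_coeff (marsden_poly \<tau> n i) j y else 0"
  have "dd T h (Suc n) (trunc_pow n x)
      = dd T h (Suc n) (\<lambda>j y. \<Sum>i\<in>{- int n..int k}. bspline_rec \<tau> n i x * ?G i j y)"
  proof (rule dd_cong)
    fix b j
    let ?y = "T b"
    assume mult: "T b = T (b + int j)"
    have "bspline_rec \<tau> n i x * ?G i j ?y
        = (if x < ?y then bspline_rec \<tau> n i x * taylor_coeff (marsden_poly \<tau> n i) j ?y else 0)"
      if i: "i \<in> {- int n..int k}" for i
    proof (cases "bspline_rec \<tau> n i x = 0 \<or> (x < ?y \<longleftrightarrow> s i < ?y)")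
      case False
      then have "\<tau> i \<le> x" "x < \<tau> (i + int n + 1)" "x < ?y \<longleftrightarrow> \<not> s i < ?y"
        using bspline_rec_support[OF \<tau>, of n i x] by auto
      \<comment> \<open>The node separates x from s i, and both of these lie in the support of the fine B-spline.\<close>
      with s[OF i] have y: "\<tau> i < ?y" "?y < \<tau> (i + int n + 1)" by auto
      from refines[OF mult this] obtain c where c: "\<tau> c = ?y" "\<tau> (c + int j) = ?y" by blast
      have "i < c" using y(1) c(1) monoD[OF \<tau>, of c i] by force
      moreover have "c + int j \<le> i + int n"
        using y(2) c(2) monoD[OF \<tau>, of "i + int n + 1" "c + int j"] by force
      ultimately have "taylor_coeff (marsden_poly \<tau> n i) j ?y = 0"
        by (intro taylor_coeff_marsden_poly_eq_0[OF \<tau> _ _ c])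
      then show ?thesis by simp
    qed auto
    then have "(\<Sum>i\<in>{- int n..int k}. bspline_rec \<tau> n i x * ?G i j ?y)
        = (\<Sum>i\<in>{- int n..int k}. if x < ?y then bspline_rec \<tau> n i x * taylor_coeff (marsden_poly \<tau> n i) j ?y else 0)"
      by (rule sum.cong[OF refl])
    also have "\<dots> = (if x < ?y then \<Sum>i\<in>{- int n..int k}. bspline_rec \<tau> n i x * taylor_coeff (marsden_poly \<tau> n i) j ?y else 0)"
      by simp
    also have "\<dots> = (if x < ?y then taylor_coeff (\<Sum>i\<in>{- int n..int k}. smult (bspline_rec \<tau> n i x) (marsden_poly \<tau> n i)) j ?y else 0)"
      by (simp add: taylor_coeff_def pcompose_sum pcompose_smult coeff_sum)
    also have "\<dots> = trunc_pow n x j ?y"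
      by (simp add: marsden_identity[OF \<tau> x] taylor_coeff_linear_power trunc_pow_def)
    finally show "trunc_pow n x j ?y = (\<Sum>i\<in>{- int n..int k}. bspline_rec \<tau> n i x * ?G i j ?y)" ..
  qed
  then have "dd T h (Suc n) (trunc_pow n x)
      = (\<Sum>i\<in>{- int n..int k}. bspline_rec \<tau> n i x * dd T h (Suc n) (?G i))"
    unfolding dd_sum .
  then show ?thesis
    unfolding bspline_rec_eq_dd[OF T, of n h]
    by (simp only: sum_distrib_left mult.assoc mult.commute[of "bspline_rec _ _ _ _"])
qed

text \<open>
  At the jump \<open>s\<close> itself, and to its left, the function vanishes on a left neighbourhood, so taking
  derivatives from the left preserves the truncation.
\<close>

lemma left_deriv_funpow_cutoff_poly:
  "(left_deriv ^^ j) (\<lambda>y. (if y > s then 1 else 0) * poly p y)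
     = (\<lambda>y. (if y > s then 1 else 0) * poly ((pderiv ^^ j) p) y)"
proof (induction j)
  case (Suc j)
  have "left_deriv (\<lambda>y. (if y > s then 1 else 0) * poly q y)
      = (\<lambda>y. (if y > s then 1 else 0) * poly (pderiv q) y)" for q
  proof
    fix y :: real
    let ?g = "\<lambda>y. (if y > s then 1 else 0) * poly q y"
    \<comment> \<open>Changing the function near y requires y to belong to the set, hence first the closed half-line.\<close>
    have "(?g has_vector_derivative (if y > s then 1 else 0) * poly (pderiv q) y) (at y within {..y})"
    proof (cases "y > s")
      case True
      have "(poly q has_vector_derivative poly (pderiv q) y) (at y within {..y})"
        using poly_DERIV[of q y] has_vector_derivative_at_within
        by (simp add: has_real_derivative_iff_has_vector_derivative)
      then have "(?g has_vector_derivative poly (pderiv q) y) (at y within {..y})"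
      proof (rule has_vector_derivative_transform_within[where d = "y - s"])
        fix z assume "dist z y < y - s"
        then show "poly q z = ?g z" by (auto simp: dist_real_def)
      qed (use True in auto)
      then show ?thesis by (simp only: True if_True mult_1)
    next
      case False
      have "((\<lambda>_. 0) has_vector_derivative 0) (at y within {..y})" by simp
      then have "(?g has_vector_derivative 0) (at y within {..y})"
        by (rule has_vector_derivative_transform_within[where d = 1]) (use False in auto)
      with False show ?thesis by simp
    qed
    then have "(?g has_vector_derivative (if y > s then 1 else 0) * poly (pderiv q) y) (at_left y)"
      by (rule has_vector_derivative_within_subset) auto
    then show "left_deriv ?g y = (if y > s then 1 else 0) * poly (pderiv q) y"
      unfolding left_deriv_def
      by (intro vector_derivative_within) simp_all
  qed
  then show ?case using Suc by simp
qed simp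


section \<open>The knot vectors\<close>

text \<open>
  All knot vectors \<open>T\<^sub>k\<close> with \<open>k \<le> m\<close> are built from the same interior knots \<open>t\<^sub>1 \<le> \<dots> \<le> t\<^sub>m\<close>.
\<close>

locale interior_knots =
  fixes t :: "nat \<Rightarrow> real" and m :: nat
  assumes t_in: "i \<in> {1..m} \<Longrightarrow> 0 < t i \<and> t i < 1"
    and t_mono: "mono_on {1..m} t"
begin

lemma knot_bounds: "k \<le> m \<Longrightarrow> 0 \<le> knot t k i \<and> knot t k i \<le> 1"
proof (cases "0 < i \<and> i \<le> int k")
  case True
  moreover assume "k \<le> m"
  ultimately have "nat i \<in> {1..m}" by auto
  from t_in[OF this] True show ?thesis by (simp add: knot_def)
qed (auto simp: knot_def)

lemma mono_knot:
  assumes "k \<le> m"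
  shows "mono (knot t k)"
proof (rule monoI)
  fix i j :: int
  assume "i \<le> j"
  consider "i \<le> 0" | "j > int k" | "0 < i" "i \<le> j" "j \<le> int k"
    using \<open>i \<le> j\<close> by linarith
  then show "knot t k i \<le> knot t k j"
  proof cases
    case 1
    then show ?thesis using knot_bounds[OF assms, of j] by (simp add: knot_def)
  next
    case 2
    have "knot t k j = 1" using 2 by (simp add: knot_def)
    then show ?thesis using knot_bounds[OF assms, of i] by simp
  next
    case 3
    then show ?thesis using mono_onD[OF t_mono, of "nat i" "nat j"] assms by (simp add: knot_def)
  qed
qed

lemma knot_refines:
  assumes "k \<le> m" and "knot t k b = knot t k (b + int j)"
    and "knot t m a < knot t k b" "knot t k b < knot t m e"
  shows "\<exists>c. knot t m c = knot t k b \<and> knot t m (c + int j) = knot t k b"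
proof (intro exI[of _ b] conjI)
  have "0 < knot t k b" "knot t k b < 1"
    using assms(3,4) knot_bounds[of m a] knot_bounds[of m e] by auto
  moreover from this have "0 < knot t k (b + int j)" "knot t k (b + int j) < 1"
    using assms(2) by auto
  ultimately have "0 < b" "b + int j \<le> int k" by (auto simp: knot_def split: if_splits)
  then show "knot t m b = knot t k b" "knot t m (b + int j) = knot t k b"
    using assms(1,2) by (auto simp: knot_def)
qed

text \<open>
  The complement in \<open>[0,1]\<close> of all knots. On this open set the splines are locally polynomials, and it
  misses only finitely many points of \<open>[0,1]\<close>, so inner products do not see the difference.
\<close>

definition off_knots :: "real set" where
  "off_knots = {0<..<1} - t ` {1..m}"

lemma open_off_knots: "open off_knots"
  unfolding off_knots_def by (intro open_Diff finite_imp_closed) auto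

lemma off_knots_knot_neq:
  assumes "x \<in> off_knots" and "k \<le> m"
  shows "knot t k b \<noteq> x"
proof (cases "0 < b \<and> b \<le> int k")
  case True
  then have "nat b \<in> {1..m}" using assms(2) by auto
  with True assms(1) show ?thesis by (auto simp: off_knots_def knot_def)
qed (use assms in \<open>auto simp: off_knots_def knot_def\<close>)

lemma bspline_off_knots: "x \<in> off_knots \<Longrightarrow> bspline t k d i x = bspline_rec (knot t k) d i x"
  by (auto simp: off_knots_def bspline_def)

lemma off_knots_range: "x \<in> off_knots \<Longrightarrow> knot t m 0 \<le> x \<and> x < knot t m (int m + 1)"
  by (auto simp: off_knots_def knot_def)

end

lemma sum_int_interval_shift:
  fixes f :: "int \<Rightarrow> 'a :: comm_monoid_add"
  shows "(\<Sum>i\<in>{- int n..int m}. f i) = (\<Sum>j\<le>n + m. f (- int n + int j))"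
  by (rule sum.reindex_bij_witness[of _ "\<lambda>j. - int n + int j" "\<lambda>i. nat (i + int n)"]) auto


section \<open>The Legendre polynomials in the B-spline basis\<close>

text \<open>
  Vieta's formula. The coefficient is counted from the top because \<open>y\<^sup>n\<^sup>-\<^sup>h\<close> is what accompanies \<open>x\<^sup>h\<close> in
  \<open>(y - x)\<^sup>n\<close>.
\<close>

lemma coeff_marsden_poly:
  assumes "h \<le> n"
  shows "coeff (marsden_poly T n i) (n - h)
    = (- 1) ^ h * (\<Sum>S | S \<subseteq> {i + 1..i + int n} \<and> card S = h. \<Prod>s\<in>S. T s)"
proof -
  let ?A = "{i + 1..i + int n}"
  have const: "(\<Prod>r\<in>X. [:- T r:]) = [:(- 1) ^ card X * (\<Prod>r\<in>X. T r):]" if "finite X" for X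
    using that by (induction X) auto
  have "marsden_poly T n i = (\<Prod>r\<in>?A. [:- T r:] + [:0, 1:])"
    by (simp add: marsden_poly_def)
  also have "\<dots> = (\<Sum>X\<in>Pow ?A. (\<Prod>r\<in>X. [:- T r:]) * (\<Prod>r\<in>?A - X. [:0, 1:]))"
    by (rule prod_add) simp
  also have "\<dots> = (\<Sum>X\<in>Pow ?A. monom ((- 1) ^ card X * (\<Prod>r\<in>X. T r)) (n - card X))"
  proof (rule sum.cong[OF refl])
    fix X assume "X \<in> Pow ?A"
    then have "finite X" "X \<subseteq> ?A" by (auto intro: finite_subset[of _ ?A])
    then show "(\<Prod>r\<in>X. [:- T r:]) * (\<Prod>r\<in>?A - X. [:0, 1:])
        = monom ((- 1) ^ card X * (\<Prod>r\<in>X. T r)) (n - card X)"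
      by (simp add: const card_Diff_subset monom_altdef)
  qed
  finally have "coeff (marsden_poly T n i) (n - h)
      = (\<Sum>X\<in>Pow ?A. if n - card X = n - h then (- 1) ^ card X * (\<Prod>r\<in>X. T r) else 0)"
    by (simp add: coeff_sum)
  also have "\<dots> = (\<Sum>X\<in>{X \<in> Pow ?A. n - card X = n - h}. (- 1) ^ card X * (\<Prod>r\<in>X. T r))"
    by (rule sum.inter_filter[symmetric]) simp
  also have "{X \<in> Pow ?A. n - card X = n - h} = {S. S \<subseteq> ?A \<and> card S = h}"
  proof -
    have "n - card X = n - h \<longleftrightarrow> card X = h" if "X \<subseteq> ?A" for X
    proof -
      have "card X \<le> n" using card_mono[OF _ that] by simp
      with assms show ?thesis by linarith
    qed
    then show ?thesis by blast
  qed
  also have "(\<Sum>X\<in>{S. S \<subseteq> ?A \<and> card S = h}. (- 1) ^ card X * (\<Prod>r\<in>X. T r))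
      = (- 1) ^ h * (\<Sum>S | S \<subseteq> ?A \<and> card S = h. \<Prod>s\<in>S. T s)"
    unfolding sum_distrib_left by (rule sum.cong[OF refl]) simp
  finally show ?thesis .
qed

text \<open>
  Comparison of the coefficients of \<open>y\<^sup>n\<^sup>-\<^sup>h\<close> on the two sides of Marsden's identity.
\<close>

lemma power_eq_sum_bspline:
  assumes T: "mono T" and x: "T 0 \<le> x" "x < T (int k + 1)" and h: "h \<le> n"
  shows "x ^ h = (\<Sum>i\<in>{- int n..int k}.
    (\<Sum>S | S \<subseteq> {i + 1..i + int n} \<and> card S = h. \<Prod>s\<in>S. T s) / real (n choose h) * bspline_rec T n i x)"
    (is "_ = (\<Sum>i\<in>_. ?E i / _ * ?N i)")
proof -
  have "(- 1) ^ h * (real (n choose h) * x ^ h) = real (n choose (n - h)) * (- x) ^ h"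
    using binomial_symmetric[OF h] by (simp add: power_minus[of x])
  also have "\<dots> = coeff ([:- x, 1:] ^ n) (n - h)"
    using h by (simp add: coeff_linear_poly_power)
  also have "\<dots> = (\<Sum>i\<in>{- int n..int k}. ?N i * ((- 1) ^ h * ?E i))"
    unfolding marsden_identity[OF T x, symmetric] by (simp add: coeff_sum coeff_marsden_poly[OF h])
  also have "\<dots> = (- 1) ^ h * (\<Sum>i\<in>{- int n..int k}. ?E i * ?N i)"
    by (simp add: sum_distrib_left ac_simps)
  finally have "real (n choose h) * x ^ h = (\<Sum>i\<in>{- int n..int k}. ?E i * ?N i)" by simp
  moreover have "real (n choose h) \<noteq> 0" using h by simp
  ultimately have "x ^ h = (\<Sum>i\<in>{- int n..int k}. ?E i * ?N i) / real (n choose h)"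
    by (simp only: eq_divide_eq mult.commute[of _ "x ^ h"]) simp
  also have "\<dots> = (\<Sum>i\<in>{- int n..int k}. ?E i / real (n choose h) * ?N i)"
    by (simp only: sum_divide_distrib[where f = "\<lambda>i. ?E i * ?N i"] times_divide_eq_left)
  finally show ?thesis .
qed

lemma deriv_funpow_poly: "(deriv ^^ j) (poly p) = poly ((pderiv ^^ j) p)" for p :: "real poly"
proof (induction j)
  case (Suc j)
  have "deriv (poly q) = poly (pderiv q)" for q :: "real poly"
    by (auto intro!: DERIV_imp_deriv)
  with Suc show ?case by simp
qed simp

lemma higher_pderiv_monom_real:
  "(pderiv ^^ m) (monom c (h + m)) = monom (pochhammer (real h + 1) m * c) h"
proof (induction m arbitrary: c)
  case (Suc m)
  show ?case
    unfolding funpow_Suc_right o_apply by (simp add: pderiv_monom Suc.IH pochhammer_Suc ac_simps)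
qed simp

text \<open>
  Rodrigues' formula gives the hypergeometric polynomial \<open>\<^sub>2F\<^sub>1(-i, i + 1; 1; x)\<close>, that is, the Legendre
  polynomial \<open>P\<^sub>i(1 - 2x)\<close>: the binomial theorem expands \<open>(1 - y)\<^sup>i y\<^sup>i\<close>, and each monomial \<open>y\<^sup>i\<^sup>+\<^sup>h\<close> is
  differentiated \<open>i\<close> times.
\<close>

lemma rodrigues_expansion:
  "1 / fact i * (deriv ^^ i) (\<lambda>y. (1 - y) ^ i * y ^ i) x
    = (\<Sum>h\<le>i. pochhammer (- real i) h * pochhammer (real i + 1) h / (fact h)\<^sup>2 * x ^ h)"
proof -
  define p where "p = (\<Sum>h\<le>i. monom ((- 1) ^ h * real (i choose h)) (i + h))"
  have "(\<lambda>y. (1 - y) ^ i * y ^ i) = poly p"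
  proof
    fix y :: real
    have "(1 - y) ^ i = (- y + 1) ^ i" by simp
    also have "\<dots> = (\<Sum>h\<le>i. real (i choose h) * (- y) ^ h * 1 ^ (i - h))" by (rule binomial_ring)
    finally show "(1 - y) ^ i * y ^ i = poly p y"
      by (simp add: p_def poly_sum poly_monom sum_distrib_left power_add power_minus[of y] ac_simps)
  qed
  then have "(deriv ^^ i) (\<lambda>y. (1 - y) ^ i * y ^ i) x = poly ((pderiv ^^ i) p) x"
    by (simp add: deriv_funpow_poly)
  also have "(pderiv ^^ i) p
      = (\<Sum>h\<le>i. monom (pochhammer (real h + 1) i * ((- 1) ^ h * real (i choose h))) h)"
    unfolding p_def higher_pderiv_sum by (simp only: add.commute[of i] higher_pderiv_monom_real)
  finally have "1 / fact i * (deriv ^^ i) (\<lambda>y. (1 - y) ^ i * y ^ i) x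
      = (\<Sum>h\<le>i. 1 / fact i * (pochhammer (real h + 1) i * ((- 1) ^ h * real (i choose h))) * x ^ h)"
    by (simp add: poly_sum poly_monom sum_distrib_left)
  also have "\<dots> = (\<Sum>h\<le>i. pochhammer (- real i) h * pochhammer (real i + 1) h / (fact h)\<^sup>2 * x ^ h)"
  proof (rule sum.cong[OF refl])
    fix h assume "h \<in> {..i}"
    have fact_split: "fact (a + b) = fact a * pochhammer (real a + 1) b" for a b
      using pochhammer_product'[of "1 :: real" a b] by (simp add: pochhammer_fact add.commute)
    have "(- 1) ^ h * real (i choose h) = pochhammer (- real i) h / fact h"
      unfolding binomial_gbinomial gbinomial_pochhammer by simp
    moreover have "1 / fact i * pochhammer (real h + 1) i = pochhammer (real i + 1) h / fact h"
      using fact_split[of h i] fact_split[of i h] by (simp add: field_simps add.commute)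
    ultimately show "1 / fact i * (pochhammer (real h + 1) i * ((- 1) ^ h * real (i choose h))) * x ^ h
        = pochhammer (- real i) h * pochhammer (real i + 1) h / (fact h)\<^sup>2 * x ^ h"
      by (simp only: mult.assoc[symmetric]) (simp add: power2_eq_square)
  qed
  finally show ?thesis .
qed

lemma (in interior_knots) legendre_eq_sum_bspline:
  assumes "i \<le> n" and "x \<in> off_knots"
  shows "L n t \<alpha> i x = (\<Sum>j\<le>n + m. phi n m t j i * bspline t m n (- int n + int j) x)"
proof -
  let ?c = "\<lambda>h. pochhammer (- real i) h * pochhammer (real i + 1) h / (fact h)\<^sup>2"
  let ?E = "\<lambda>h j. \<Sum>S | S \<subseteq> {- int n + int j + 1..int j} \<and> card S = h. \<Prod>s\<in>S. knot t m s"
  let ?N = "\<lambda>j. bspline t m n (- int n + int j) x"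
  have x01: "0 \<le> x" "x \<le> 1" using assms(2) by (auto simp: off_knots_def)
  then have "L n t \<alpha> i x = (\<Sum>h\<le>i. ?c h * x ^ h)"
    using assms(1) by (simp only: L_def on01_def rodrigues_expansion if_True simp_thms)
  also have "\<dots> = (\<Sum>h\<le>i. ?c h * (\<Sum>j\<le>n + m. ?E h j / real (n choose h) * ?N j))"
  proof (rule sum.cong[OF refl])
    fix h assume "h \<in> {..i}"
    then have "h \<le> n" using assms(1) by simp
    have "x ^ h = (\<Sum>j\<le>n + m. ?E h j / real (n choose h) * ?N j)"
      using power_eq_sum_bspline[OF mono_knot[OF order_refl] _ _ \<open>h \<le> n\<close>, of x m]
        off_knots_range[OF assms(2)]
      unfolding sum_int_interval_shift by (simp add: bspline_off_knots[OF assms(2)])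
    then show "?c h * x ^ h = ?c h * (\<Sum>j\<le>n + m. ?E h j / real (n choose h) * ?N j)"
      by (rule arg_cong)
  qed
  also have "\<dots> = (\<Sum>j\<le>n + m. \<Sum>h\<le>i. ?c h * (?E h j / real (n choose h) * ?N j))"
    unfolding sum_distrib_left by (rule sum.swap)
  also have "\<dots> = (\<Sum>j\<le>n + m. phi n m t j i * ?N j)"
    unfolding phi_def sum_distrib_right by (intro sum.cong refl) (simp add: mult_ac)
  finally show ?thesis .
qed

lemma phi_0: "phi n m t j 0 = 1"
proof -
  have "{S. S \<subseteq> {- int n + int j + 1..int j} \<and> card S = 0} = {{}}"
    by (auto dest: finite_subset)
  then show ?thesis by (simp add: phi_def)
qed


section \<open>Iterated derivatives of B-splines\<close>

lemma lam_outside: "q < 0 \<or> q > int v \<Longrightarrow> lam n t j k v q = 0"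
  by (cases v) auto

context interior_knots
begin

text \<open>
  One row of the scheme \<open>\<lambda>\<close> corresponds to one differentiation. By the formula for the derivative, the sum
  of \<open>\<lambda>\<^sub>v\<^sub>,\<^sub>q N\<^sub>q\<close> has a derivative proportional to the sum of \<open>\<lambda>\<^sub>v\<^sub>,\<^sub>q (u\<^sub>q - u\<^sub>q\<^sub>+\<^sub>1)\<close>, where the \<open>u\<^sub>q\<close> are the B-splines
  of the next lower degree divided by the lengths of their supports; summation by parts moves the
  difference to \<open>\<lambda>\<close>. The zero denominators match: they make \<open>u\<^sub>q\<close> and the next row of \<open>\<lambda>\<close> zero together.
\<close>

lemma lam_bspline_has_derivative:
  fixes j k n v :: nat
  assumes "k \<le> m" and x: "x \<in> off_knots" and v: "v \<le> 2 * n"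
  defines "N \<equiv> \<lambda>d q. bspline_rec (knot t k) d (- int n + int j + q)"
  shows "((\<lambda>x. \<Sum>q\<in>{0..int v}. lam n t j k v q * N (2 * n + 1 - v) q x) has_real_derivative
    real (2 * n + 1 - v) * (\<Sum>q\<in>{0..int (Suc v)}. lam n t j k (Suc v) q * N (2 * n + 1 - Suc v) q x)) (at x)"
proof -
  define d where "d = 2 * n - v"
  have d: "2 * n + 1 - v = Suc d" "2 * n + 1 - Suc v = d" using v by (auto simp: d_def)
  define u where "u q = N d q x / (knot t k (- int n + int j + q + int (Suc d)) - knot t k (- int n + int j + q))" for q
  have lam_Suc: "lam n t j k (Suc v) q * N d q x = (lam n t j k v q - lam n t j k v (q - 1)) * u q"
    if "q \<in> {0..int (Suc v)}" for q
  proof -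
    have "- int n + int j + q + int (Suc d) = int n + int j + q - int (Suc v) + 2"
      using v by (simp add: d_def)
    then show ?thesis using that by (simp only: u_def) simp
  qed
  have N': "(N (Suc d) q has_real_derivative real (Suc d) * (u q - u (q + 1))) (at x)" for q
    using bspline_rec_has_derivative[OF mono_knot[OF assms(1)] off_knots_knot_neq[OF x assms(1)],
        of d "- int n + int j + q"]
    by (simp only: N_def u_def add.assoc)
  have "((\<lambda>x. \<Sum>q\<in>{0..int v}. lam n t j k v q * N (Suc d) q x) has_real_derivative
      (\<Sum>q\<in>{0..int v}. lam n t j k v q * (real (Suc d) * (u q - u (q + 1))))) (at x)"
    by (intro DERIV_sum DERIV_cmult N')
  \<comment> \<open>The summation by parts: shift the index in the second sum, then extend both sums to 0..v + 1,
    where the additional entries of the scheme are zero.\<close>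
  also have "(\<Sum>q\<in>{0..int v}. lam n t j k v q * (real (Suc d) * (u q - u (q + 1))))
      = real (Suc d) * ((\<Sum>q\<in>{0..int v}. lam n t j k v q * u q)
          - (\<Sum>q\<in>{0..int v}. lam n t j k v (q + 1 - 1) * u (q + 1)))"
    by (simp add: sum_distrib_left sum_subtractf[symmetric] algebra_simps del: of_nat_Suc)
  also have "(\<Sum>q\<in>{0..int v}. lam n t j k v (q + 1 - 1) * u (q + 1))
      = (\<Sum>q\<in>{1..int (Suc v)}. lam n t j k v (q - 1) * u q)"
    by (rule sum.reindex_bij_witness[of _ "\<lambda>q. q - 1" "\<lambda>q. q + 1"]) auto
  also have "\<dots> = (\<Sum>q\<in>{0..int (Suc v)}. lam n t j k v (q - 1) * u q)"
    by (rule sum.mono_neutral_left) (auto intro!: lam_outside simp del: lam.simps)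
  also have "(\<Sum>q\<in>{0..int v}. lam n t j k v q * u q) = (\<Sum>q\<in>{0..int (Suc v)}. lam n t j k v q * u q)"
    by (rule sum.mono_neutral_left) (auto intro!: lam_outside simp del: lam.simps)
  also have "(\<Sum>q\<in>{0..int (Suc v)}. lam n t j k v q * u q) - (\<Sum>q\<in>{0..int (Suc v)}. lam n t j k v (q - 1) * u q)
      = (\<Sum>q\<in>{0..int (Suc v)}. lam n t j k (Suc v) q * N d q x)"
    unfolding sum_subtractf[symmetric] left_diff_distrib[symmetric]
    by (rule sum.cong[OF refl]) (simp only: lam_Suc)
  finally show ?thesis unfolding d .
qed

lemma deriv01_eqI:
  assumes "x \<in> off_knots" and "(g has_real_derivative D) (at x)"
  shows "deriv01 g x = D"
  unfolding deriv01_def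
proof (rule vector_derivative_within_closed_interval)
  show "(g has_vector_derivative D) (at x within {0..1})"
    by (rule has_vector_derivative_at_within)
      (use assms(2) in \<open>simp add: has_real_derivative_iff_has_vector_derivative\<close>)
qed (use assms(1) in \<open>auto simp: off_knots_def\<close>)

text \<open>
  Since \<open>off_knots\<close> is open, a formula for the \<open>v\<close>-th derivative there can be differentiated again without
  looking at the knots.
\<close>

lemma deriv01_funpow_f_fun:
  assumes k: "k \<le> m" and "v \<le> 2 * n + 1" and "x \<in> off_knots"
  shows "(deriv01 ^^ v) (f_fun n t \<alpha> k) x = fact (2 * n + 1) / fact (2 * n + 1 - v) *
    (\<Sum>j<k. \<alpha> (- int n + int j) k * (\<Sum>q\<in>{0..int v}. lam n t j k v q
       * bspline_rec (knot t k) (2 * n + 1 - v) (- int n + int j + q) x))"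
  using assms(2,3)
proof (induction v arbitrary: x)
  case 0
  then show ?case by (simp add: f_fun_def bspline_off_knots del: bspline_rec.simps)
next
  case (Suc v)
  let ?S = "\<lambda>v x. \<Sum>j<k. \<alpha> (- int n + int j) k * (\<Sum>q\<in>{0..int v}. lam n t j k v q
       * bspline_rec (knot t k) (2 * n + 1 - v) (- int n + int j + q) x)"
  let ?c = "\<lambda>v. fact (2 * n + 1) / fact (2 * n + 1 - v) :: real"
  have "((\<lambda>x. ?c v * ?S v x) has_real_derivative
      ?c v * (\<Sum>j<k. \<alpha> (- int n + int j) k * (real (2 * n + 1 - v) * (\<Sum>q\<in>{0..int (Suc v)}. lam n t j k (Suc v) q
       * bspline_rec (knot t k) (2 * n + 1 - Suc v) (- int n + int j + q) x)))) (at x)"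
    using Suc.prems by (intro DERIV_cmult DERIV_sum lam_bspline_has_derivative k) auto
  also have "?c v * (\<Sum>j<k. \<alpha> (- int n + int j) k * (real (2 * n + 1 - v) * (\<Sum>q\<in>{0..int (Suc v)}. lam n t j k (Suc v) q
       * bspline_rec (knot t k) (2 * n + 1 - Suc v) (- int n + int j + q) x)))
      = (?c v * real (2 * n + 1 - v)) * ?S (Suc v) x"
    by (simp only: mult.left_commute[of _ "real (2 * n + 1 - v)"] sum_distrib_left[symmetric] mult.assoc)
  also have "?c v * real (2 * n + 1 - v) = ?c (Suc v)"
  proof -
    have "2 * n + 1 - v = Suc (2 * n + 1 - Suc v)" using Suc.prems by simp
    then have "(fact (2 * n + 1 - v) :: real) = real (2 * n + 1 - v) * fact (2 * n + 1 - Suc v)"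
      by (metis fact_Suc)
    moreover have "real (2 * n + 1 - v) \<noteq> 0" using Suc.prems by simp
    ultimately show ?thesis by (simp del: fact_Suc of_nat_diff)
  qed
  finally have "((deriv01 ^^ v) (f_fun n t \<alpha> k) has_real_derivative ?c (Suc v) * ?S (Suc v) x) (at x)"
    by (rule has_field_derivative_transform_within_open[OF _ open_off_knots])
      (use Suc in auto)
  then show ?case using deriv01_eqI[OF Suc.prems(2)] by (simp only: funpow.simps o_apply)
qed

text \<open>
  After \<open>n + 1\<close> derivatives the degree \<open>2n + 1\<close> has dropped to \<open>n\<close>; collecting the contributions to the
  B-spline with index \<open>h = j + q\<close> gives \<open>\<beta>\<close>.
\<close>

lemma L_eq_sum_beta_bspline:
  assumes k: "1 \<le> k" "k \<le> m" and x: "x \<in> off_knots"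
  shows "L n t \<alpha> (n + k) x
    = (\<Sum>h\<le>n + k. beta n t \<alpha> h k * bspline_rec (knot t k) n (- int n + int h) x)"
proof -
  let ?N = "\<lambda>i. bspline_rec (knot t k) n i x"
  have inner: "(\<Sum>q\<in>{0..int (n + 1)}. lam n t j k (n + 1) q * ?N (- int n + int j + q))
      = (\<Sum>h\<le>n + k. lam n t j k (n + 1) (int h - int j) * ?N (- int n + int h))" if "j < k" for j
  proof -
    have "(\<Sum>q\<in>{0..int (n + 1)}. lam n t j k (n + 1) q * ?N (- int n + int j + q))
        = (\<Sum>h\<in>{j..j + n + 1}. lam n t j k (n + 1) (int h - int j) * ?N (- int n + int h))"
      by (rule sum.reindex_bij_witness[of _ "\<lambda>h. int h - int j" "\<lambda>q. nat (q + int j)"])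
        (auto simp: algebra_simps simp del: lam.simps)
    also have "\<dots> = (\<Sum>h\<le>n + k. lam n t j k (n + 1) (int h - int j) * ?N (- int n + int h))"
      using that by (intro sum.mono_neutral_left) (auto intro!: lam_outside simp del: lam.simps)
    finally show ?thesis .
  qed
  have "0 \<le> x \<and> x \<le> 1" using x by (auto simp: off_knots_def)
  then have "L n t \<alpha> (n + k) x = (deriv01 ^^ (n + 1)) (f_fun n t \<alpha> k) x"
    using k(1) by (simp add: L_def on01_def)
  also have "\<dots> = fact (2 * n + 1) / fact n * (\<Sum>j<k. \<alpha> (- int n + int j) k *
      (\<Sum>h\<le>n + k. lam n t j k (n + 1) (int h - int j) * ?N (- int n + int h)))"
  proof -
    have "2 * n + 1 - (n + 1) = n" "n + 1 \<le> 2 * n + 1" by simp_all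
    with inner deriv01_funpow_f_fun[OF k(2) _ x, of "n + 1" n \<alpha>] show ?thesis by simp
  qed
  also have "\<dots> = (\<Sum>h\<le>n + k. beta n t \<alpha> h k * ?N (- int n + int h))"
    unfolding beta_def sum_distrib_left sum_distrib_right
    by (subst sum.swap) (simp only: mult.assoc)
  finally show ?thesis .
qed

end


section \<open>B-spline coefficients of the orthogonal basis\<close>

lemma g_fun_eq:
  "g_fun n m t s i = (\<lambda>y. (if y > s i then 1 else 0)
     * poly (marsden_poly (knot t m) n (- int n + int i)) y)"
proof
  fix y
  have "(\<Prod>r = 1..n. y - knot t m (- int n + int i + int r))
      = (\<Prod>r\<in>{- int n + int i + 1..- int n + int i + int n}. y - knot t m r)"
    by (rule prod.reindex_bij_witness[of _ "\<lambda>r. nat (r + int n - int i)" "\<lambda>r. - int n + int i + int r"]) auto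
  then show "g_fun n m t s i y = (if y > s i then 1 else 0)
     * poly (marsden_poly (knot t m) n (- int n + int i)) y"
    by (simp add: g_fun_def marsden_poly_def poly_prod)
qed

lemma divdiff_g_fun:
  "divdiff T a l (g_fun n m t s i) = dd T a l (\<lambda>j y.
     if s i < y then taylor_coeff (marsden_poly (knot t m) n (- int n + int i)) j y else 0)"
proof -
  have "(left_deriv ^^ j) (g_fun n m t s i) y / fact j =
      (if s i < y then taylor_coeff (marsden_poly (knot t m) n (- int n + int i)) j y else 0)" for j y
    unfolding g_fun_eq left_deriv_funpow_cutoff_poly taylor_coeff_eq_deriv by simp
  then show ?thesis by (simp only: divdiff_eq_dd)
qed

text \<open>
  The coefficients \<open>\<psi>\<close> of the dual functions are the B-spline coefficients of the orthogonal basis: from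
  Marsden's identity for the Legendre part, directly from \<open>\<beta>\<close> for \<open>L\<^sub>n\<^sub>+\<^sub>m\<close>, whose knots are already those of
  \<open>T\<^sub>m\<close>, and by knot insertion from \<open>T\<^sub>k\<close> to \<open>T\<^sub>m\<close> in between.
\<close>

theorem (in interior_knots) L_eq_sum_psi_bspline:
  assumes x: "x \<in> off_knots" and i: "i \<le> n + m"
    and s: "\<And>j. j \<le> n + m \<Longrightarrow> s j \<in> {knot t m (- int n + int j)..<knot t m (int j + 1)}"
  shows "L n t \<alpha> i x = (\<Sum>j\<le>n + m. psi n m t \<alpha> s j i * bspline t m n (- int n + int j) x)"
proof -
  consider "i \<le> n" | "i = n + m" "n < i" | "n < i" "i < n + m" using i by linarith
  then show ?thesis
  proof cases
    case 1
    then have "psi n m t \<alpha> s j i = phi n m t j i" for j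
      by (simp add: psi_def phi_0)
    with 1 show ?thesis by (simp add: legendre_eq_sum_bspline[OF _ x])
  next
    case 2
    then show ?thesis
      using L_eq_sum_beta_bspline[of m x n \<alpha>] x by (simp add: psi_def bspline_off_knots)
  next
    case 3
    define k where "k = i - n"
    have k: "1 \<le> k" "k \<le> m" "i = n + k" using 3 by (auto simp: k_def)
    let ?a = "\<lambda>j h. (knot t k (int h + 1) - knot t k (- int n + int h))
      * divdiff (knot t k) (- int n + int h) (n + 1) (g_fun n m t s j)"
    have "bspline_rec (knot t k) n (- int n + int h) x
        = (\<Sum>j\<le>n + m. ?a j h * bspline_rec (knot t m) n (- int n + int j) x)" for h
    proof -
      have s': "knot t m i \<le> s (nat (i + int n)) \<and> s (nat (i + int n)) < knot t m (i + int n + 1)"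
        if "i \<in> {- int n..int m}" for i
        using s[of "nat (i + int n)"] that by (auto simp: nat_le_iff)
      have "bspline_rec (knot t k) n (- int n + int h) x = (\<Sum>i\<in>{- int n..int m}.
          (knot t k (- int n + int h + int n + 1) - knot t k (- int n + int h))
          * dd (knot t k) (- int n + int h) (Suc n) (\<lambda>j y. if s (nat (i + int n)) < y
              then taylor_coeff (marsden_poly (knot t m) n i) j y else 0)
          * bspline_rec (knot t m) n i x)"
        using off_knots_range[OF x]
        by (intro knot_insertion mono_knot k(2) order_refl s' knot_refines) auto
      then show ?thesis
        unfolding sum_int_interval_shift divdiff_g_fun by (simp del: dd.simps)
    qed
    then have "L n t \<alpha> i x = (\<Sum>h\<le>n + k. beta n t \<alpha> h k
        * (\<Sum>j\<le>n + m. ?a j h * bspline_rec (knot t m) n (- int n + int j) x))"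
      unfolding k(3) L_eq_sum_beta_bspline[OF k(1,2) x] by simp
    also have "\<dots> = (\<Sum>j\<le>n + m. gamma n m t \<alpha> s j k * bspline_rec (knot t m) n (- int n + int j) x)"
      unfolding gamma_def sum_distrib_left sum_distrib_right
      by (subst sum.swap) (simp only: mult.assoc)
    also have "\<dots> = (\<Sum>j\<le>n + m. psi n m t \<alpha> s j i * bspline t m n (- int n + int j) x)"
      using 3 by (simp add: psi_def k_def bspline_off_knots[OF x])
    finally show ?thesis .
  qed
qed

section \<open>Inner products of piecewise polynomials\<close>

context interior_knots
begin

text \<open>
  Polynomial pieces on half-open knot intervals, with no smoothness at the knots: a class that contains
  B-splines, splines and their products, and in which every function is integrable.
\<close>

definition piecewise_poly :: "(real \<Rightarrow> real) \<Rightarrow> bool" where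
  "piecewise_poly f \<longleftrightarrow> (\<forall>i\<in>{0..int m}. \<exists>p :: real poly.
     \<forall>x\<in>{knot t m i..<knot t m (i + 1)}. f x = poly p x)"

lemma piecewise_poly_mult:
  assumes "piecewise_poly f" "piecewise_poly g"
  shows "piecewise_poly (\<lambda>x. f x * g x)"
  unfolding piecewise_poly_def
proof
  fix i assume "i \<in> {0..int m}"
  then obtain p q :: "real poly" where "\<forall>x\<in>{knot t m i..<knot t m (i + 1)}. f x = poly p x"
    "\<forall>x\<in>{knot t m i..<knot t m (i + 1)}. g x = poly q x"
    using assms unfolding piecewise_poly_def by blast
  then show "\<exists>p. \<forall>x\<in>{knot t m i..<knot t m (i + 1)}. f x * g x = poly p x"
    by (intro exI[of _ "p * q"]) simp
qed

lemma piecewise_poly_bspline: "piecewise_poly (bspline t m d i)"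
  unfolding piecewise_poly_def
proof
  fix r
  let ?J = "{knot t m r..<knot t m (r + 1)}"
  have "\<exists>p. \<forall>x\<in>?J. bspline_rec (knot t m) d i x = poly p x"
  proof (induction d arbitrary: i)
    case 0
    have "bspline_rec (knot t m) 0 i x = poly (if i = r then 1 else 0) x" if "x \<in> ?J" for x
    proof (cases "i = r")
      case False
      then have "\<not> (knot t m i \<le> x \<and> x < knot t m (i + 1))"
        using knot_interval_unique[OF mono_knot[OF order_refl], of i x r] that by auto
      with False show ?thesis by (simp only: bspline_rec.simps if_False poly_0)
    qed (use that in simp)
    then show ?case by blast
  next
    case (Suc d)
    obtain p q where "\<forall>x\<in>?J. bspline_rec (knot t m) d i x = poly p x"
      "\<forall>x\<in>?J. bspline_rec (knot t m) d (i + 1) x = poly q x"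
      using Suc by metis
    then have "\<forall>x\<in>?J. bspline_rec (knot t m) (Suc d) i x = poly
       (smult (1 / (knot t m (i + int (Suc d)) - knot t m i)) ([:- knot t m i, 1:] * p)
        + smult (1 / (knot t m (i + int (Suc d) + 1) - knot t m (i + 1))) ([:knot t m (i + int (Suc d) + 1), -1:] * q)) x"
      by (simp add: left_diff_distrib del: of_nat_Suc)
    then show ?case by blast
  qed
  moreover have "bspline t m d i x = bspline_rec (knot t m) d i x" if "x \<in> ?J" for x
    using that knot_bounds[of m "r + 1"] by (auto simp: bspline_def)
  ultimately show "\<exists>p. \<forall>x\<in>?J. bspline t m d i x = poly p x" by simp
qed

lemma piecewise_poly_integrable:
  assumes "piecewise_poly f"
  shows "f integrable_on {0..1}"
proof -
  have "f integrable_on {0..knot t m (int k)}" if "k \<le> Suc m" for k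
    using that
  proof (induction k)
    case 0
    show ?case using integrable_on_refl[of f 0] by (simp add: knot_def)
  next
    case (Suc k)
    let ?a = "knot t m (int k)" and ?b = "knot t m (int k + 1)"
    obtain p where p: "\<forall>x\<in>{?a..<?b}. f x = poly p x"
      using assms Suc.prems unfolding piecewise_poly_def by force
    have "poly p integrable_on {?a..?b}"
      by (intro integrable_continuous_real continuous_intros)
    then have "f integrable_on {?a..?b}"
      by (rule integrable_spike_finite[of "{?b}", rotated 2]) (use p in auto)
    moreover have "?a \<le> ?b" by (intro monoD[OF mono_knot[OF order_refl]]) simp
    moreover have "0 \<le> ?a" using knot_bounds by simp
    ultimately have "f integrable_on {0..?b}"
      using Suc by (intro Henstock_Kurzweil_Integration.integrable_combine[of 0 ?a ?b]) auto
    then show ?case by (simp add: add.commute)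
  qed
  from this[of "Suc m"] show ?thesis by (simp add: knot_def)
qed

text \<open>
  On a nonempty knot interval the square of the polynomial piece is continuous, nonnegative and has
  integral zero. The half-open intervals cover \<open>[0,1)\<close>, so knots are included.
\<close>

lemma piecewise_poly_inner_self_eq_0:
  assumes f: "piecewise_poly f" and "inner_L f f = 0" and x: "0 \<le> x" "x < 1"
  shows "f x = 0"
proof -
  obtain i where i: "i \<in> {0..int m}" "knot t m i \<le> x" "x < knot t m (i + 1)"
    using knot_interval_exists[of "knot t m" x m] x by (auto simp: knot_def)
  let ?a = "knot t m i" and ?b = "knot t m (i + 1)"
  obtain p where p: "\<forall>x\<in>{?a..<?b}. f x = poly p x"
    using f i(1) unfolding piecewise_poly_def by blast
  have int: "(\<lambda>x. f x * f x) integrable_on {0..1}"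
    by (intro piecewise_poly_integrable piecewise_poly_mult f)
  have sub: "{?a..?b} \<subseteq> {0..1}" using knot_bounds[of m i] knot_bounds[of m "i + 1"] by auto
  have eq: "integral {?a..?b} (\<lambda>x. poly p x * poly p x) = integral {?a..?b} (\<lambda>x. f x * f x)"
    by (rule integral_spike[of "{?b}"]) (use p in auto)
  also have "\<dots> \<le> integral {0..1} (\<lambda>x. f x * f x)"
    using int sub by (intro integral_subset_le integrable_on_subinterval[OF int]) auto
  also have "\<dots> = 0" using assms(2) by (simp add: inner_L_def)
  finally have "integral {?a..?b} (\<lambda>x. poly p x * poly p x) \<le> 0" .
  moreover have "0 \<le> integral {?a..?b} (\<lambda>x. poly p x * poly p x)"
    by (intro integral_nonneg integrable_continuous_real continuous_intros) auto
  ultimately have "integral {?a..?b} (\<lambda>x. poly p x * poly p x) = 0" by simp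
  moreover have "continuous_on {?a..?b} (\<lambda>x. poly p x * poly p x)" by (intro continuous_intros)
  ultimately have "\<forall>x\<in>{?a..?b}. poly p x * poly p x = 0"
    using i by (subst (asm) integral_eq_0_iff) auto
  with p i show ?thesis by auto
qed

lemma spline_space_piecewise_poly: "f \<in> spline_space t n m \<Longrightarrow> piecewise_poly f"
  unfolding spline_space_def piecewise_poly_def by blast

text \<open>
  The inner product is definite on splines because they are determined by their values on \<open>[0,1)\<close>: they
  take the left limit at \<open>1\<close> and vanish outside \<open>[0,1]\<close>.
\<close>

lemma spline_inner_self_neq_0:
  assumes f: "f \<in> spline_space t n m" and "f \<noteq> 0"
  shows "inner_L f f \<noteq> 0"
proof
  assume "inner_L f f = 0"
  then have zero: "f x = 0" if "0 \<le> x" "x < 1" for x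
    using piecewise_poly_inner_self_eq_0[OF spline_space_piecewise_poly[OF f]] that by blast
  have "\<forall>\<^sub>F x in at_left 1. f x = 0"
    using eventually_at_left_real[of 0 1] by (auto elim!: eventually_mono intro!: zero)
  then have "(f \<longlongrightarrow> 0) (at_left 1)" by (rule tendsto_eventually)
  moreover have "(f \<longlongrightarrow> f 1) (at_left 1)" using f by (simp add: spline_space_def)
  ultimately have "f 1 = 0" using tendsto_unique[OF trivial_limit_at_left_real] by blast
  moreover have "f x = 0" if "x \<notin> {0..1}" for x using f that by (simp add: spline_space_def)
  ultimately have "f x = 0" for x
    using zero by (cases "x \<in> {0..1}"; cases "x = 1") auto
  with \<open>f \<noteq> 0\<close> show False by (auto simp: fun_eq_iff)
qed

lemma inner_L_sum_right:
  assumes "piecewise_poly f" and "\<And>i. i \<in> I \<Longrightarrow> piecewise_poly (g i)" and "finite I"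
  shows "inner_L f (\<lambda>x. \<Sum>i\<in>I. c i * g i x) = (\<Sum>i\<in>I. c i * inner_L f (g i))"
proof -
  have "inner_L f (\<lambda>x. \<Sum>i\<in>I. c i * g i x) = integral {0..1} (\<lambda>x. \<Sum>i\<in>I. c i * (f x * g i x))"
    by (simp add: inner_L_def sum_distrib_left ac_simps)
  also have "\<dots> = (\<Sum>i\<in>I. integral {0..1} (\<lambda>x. c i * (f x * g i x)))"
    using assms by (intro integral_sum integrable_on_mult_right piecewise_poly_integrable piecewise_poly_mult) auto
  finally show ?thesis by (simp add: inner_L_def)
qed

lemma inner_L_cong_off_knots:
  assumes "\<And>x. x \<in> off_knots \<Longrightarrow> f x = f' x"
  shows "inner_L g f = inner_L g f'"
  unfolding inner_L_def
proof (rule integral_spike[of "{0, 1} \<union> t ` {1..m}"])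
  show "negligible ({0, 1} \<union> t ` {1..m})" by (intro negligible_finite) simp
  fix x assume "x \<in> {0..1} - ({0, 1} \<union> t ` {1..m})"
  then have "x \<in> off_knots" by (auto simp: off_knots_def)
  then show "g x * f' x = g x * f x" using assms by simp
qed

end


section \<open>Dual bases\<close>

lemma sum_fscale_apply: "(\<Sum>i\<in>I. fscale (c i) (B i)) x = (\<Sum>i\<in>I. c i * B i x)"
  by (induction I rule: infinite_finite_induct) (auto simp: fscale_def)

lemma basis_family_coeffs_eq:
  assumes "basis_family B I V" and "finite I"
    and eq: "\<And>x. (\<Sum>i\<in>I. c i * B i x) = (\<Sum>i\<in>I. c' i * B i x)" and "i \<in> I"
  shows "c i = c' i"
proof -
  have inj: "inj_on B I" and ind: "\<not> fun_vs.dependent (B ` I)"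
    using assms(1) by (auto simp: basis_family_def)
  define u where "u v = c (the_inv_into I B v) - c' (the_inv_into I B v)" for v
  have u: "u (B i) = c i - c' i" if "i \<in> I" for i
    using that by (simp add: u_def the_inv_into_f_f[OF inj])
  have "(\<Sum>v\<in>B ` I. fscale (u v) v) = (\<Sum>i\<in>I. fscale (c i - c' i) (B i))"
    by (simp add: sum.reindex[OF inj] u)
  also have "\<dots> = 0"
    by (rule ext) (simp add: sum_fscale_apply left_diff_distrib sum_subtractf eq)
  finally have "u (B i) = 0"
    using fun_vs.independentD[OF ind, of "B ` I" u] assms(2,4) by auto
  with u[OF assms(4)] show ?thesis by simp
qed

text \<open>
  The second hypothesis makes the family \<open>D\<close> span the space of the basis \<open>B\<close>, and a spanning family with as
  many members as a basis is a basis: an independent subset that still spans has at least as many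
  elements, so it is all of the family, and no member is repeated.
\<close>

lemma basis_family_change:
  assumes B: "basis_family B I V" and "finite I"
    and D: "\<And>j. j \<in> I \<Longrightarrow> D j = (\<Sum>i\<in>I. fscale (c j i) (B i))"
    and B_D: "\<And>i. i \<in> I \<Longrightarrow> B i = (\<Sum>j\<in>I. fscale (g i j) (D j))"
  shows "basis_family D I V"
proof -
  have inj: "inj_on B I" and ind: "\<not> fun_vs.dependent (B ` I)" and V: "fun_vs.span (B ` I) = V"
    using B by (auto simp: basis_family_def)
  have "D ` I \<subseteq> fun_vs.span (B ` I)"
  proof
    fix v assume "v \<in> D ` I"
    then obtain j where j: "j \<in> I" "v = D j" by blast
    show "v \<in> fun_vs.span (B ` I)"
      unfolding j(2) D[OF j(1)] by (intro fun_vs.span_sum fun_vs.span_scale fun_vs.span_base imageI)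
  qed
  moreover have B_span: "B ` I \<subseteq> fun_vs.span (D ` I)"
  proof
    fix v assume "v \<in> B ` I"
    then obtain i where i: "i \<in> I" "v = B i" by blast
    show "v \<in> fun_vs.span (D ` I)"
      unfolding i(2) B_D[OF i(1)] by (intro fun_vs.span_sum fun_vs.span_scale fun_vs.span_base imageI)
  qed
  ultimately have span: "fun_vs.span (D ` I) = V"
    unfolding V[symmetric] by (simp add: fun_vs.span_eq)
  obtain C where C: "C \<subseteq> D ` I" "\<not> fun_vs.dependent C" "D ` I \<subseteq> fun_vs.span C"
    by (rule fun_vs.maximal_independent_subset)
  have "finite C" using C(1) \<open>finite I\<close> finite_subset by blast
  moreover have "fun_vs.span (D ` I) \<subseteq> fun_vs.span C"
    using C(3) fun_vs.span_minimal fun_vs.subspace_span by blast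
  ultimately have "card (B ` I) \<le> card C"
    using B_span fun_vs.independent_span_bound[OF _ ind] by blast
  then have "card I \<le> card C" by (simp add: card_image[OF inj])
  moreover have "card C \<le> card (D ` I)" using C(1) \<open>finite I\<close> by (intro card_mono) auto
  moreover have "card (D ` I) \<le> card I" using \<open>finite I\<close> by (rule card_image_le)
  ultimately have "card C = card (D ` I)" "card (D ` I) = card I" by auto
  with C(1) \<open>finite I\<close> have "C = D ` I" "inj_on D I"
    by (simp_all add: card_subset_eq eq_card_imp_inj_on)
  with C(2) span show ?thesis by (simp add: basis_family_def)
qed

theorem theorem3p3:
  fixes n m :: nat and t s :: "nat \<Rightarrow> real" and \<alpha> :: "int \<Rightarrow> nat \<Rightarrow> real"
  assumes "n \<ge> 1" and "m \<ge> 1"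
    and "0 < t 1" and "mono_on {1..m} t" and "t m < 1"
    and "\<And>x. card {i\<in>{1..m}. t i = x} \<le> n"
    and "orthogonal_basis (L n t \<alpha>) {0..n + m} (spline_space t n m)"
    and "\<And>i. i \<le> n + m \<Longrightarrow> s i \<in> {knot t m (- int n + int i)..<knot t m (int i + 1)}"
  shows "basis_family (dual_fun n m t \<alpha> s) {0..n + m} (spline_space t n m) \<and>
    (\<forall>i\<le>n + m. \<forall>j\<le>n + m.
       inner_L (bspline t m n (- int n + int i)) (dual_fun n m t \<alpha> s j) = (if i = j then 1 else 0))"
proof -
  interpret interior_knots t m
  proof
    fix i assume i: "i \<in> {1..m}"
    then have "t 1 \<le> t i" "t i \<le> t m" by (auto intro!: mono_onD[OF assms(4)])
    with assms(3,5) show "0 < t i \<and> t i < 1" by simp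
  qed (rule assms(4))
  let ?I = "{0..n + m}" and ?L = "L n t \<alpha>" and ?D = "dual_fun n m t \<alpha> s"
  let ?N = "\<lambda>j. bspline t m n (- int n + int j)"
  let ?\<psi> = "psi n m t \<alpha> s" and ?\<rho> = "rho n m t \<alpha> s"
  have L_basis: "basis_family ?L ?I (spline_space t n m)"
    and orth: "\<And>i j. i \<in> ?I \<Longrightarrow> j \<in> ?I \<Longrightarrow> i \<noteq> j \<Longrightarrow> inner_L (?L i) (?L j) = 0"
    using assms(7) by (auto simp: orthogonal_basis_def)
  have L_spline: "?L i \<in> spline_space t n m" if "i \<in> ?I" for i
  proof -
    have "?L i \<in> fun_vs.span (?L ` ?I)" using that by (intro fun_vs.span_base imageI)
    then show ?thesis using L_basis by (simp add: basis_family_def)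
  qed
  have L_pp: "piecewise_poly (?L i)" if "i \<in> ?I" for i
    using spline_space_piecewise_poly[OF L_spline[OF that]] .
  have norm: "inner_L (?L i) (?L i) \<noteq> 0" if "i \<in> ?I" for i
  proof (rule spline_inner_self_neq_0[OF L_spline[OF that]])
    show "?L i \<noteq> 0"
      using L_basis that fun_vs.dependent_zero[of "?L ` ?I"]
      unfolding basis_family_def by (metis imageI)
  qed
  \<comment> \<open>The left side is the inner product of L i' with L i, with L i' written in B-splines.\<close>
  have gram: "(\<Sum>j\<in>?I. ?\<psi> j i' * inner_L (?N j) (?L i)) = (if i = i' then inner_L (?L i) (?L i) else 0)"
    if i: "i \<in> ?I" "i' \<in> ?I" for i i'
  proof -
    have "(\<Sum>j\<in>?I. ?\<psi> j i' * inner_L (?N j) (?L i)) = (\<Sum>j\<in>?I. ?\<psi> j i' * inner_L (?L i) (?N j))"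
      by (simp add: inner_L_def mult.commute)
    also have "\<dots> = inner_L (?L i) (\<lambda>x. \<Sum>j\<in>?I. ?\<psi> j i' * ?N j x)"
      using i by (intro inner_L_sum_right[symmetric] L_pp piecewise_poly_bspline) auto
    also have "\<dots> = inner_L (?L i) (?L i')"
    proof (rule inner_L_cong_off_knots)
      fix x assume "x \<in> off_knots"
      from L_eq_sum_psi_bspline[OF this _ assms(8), of i' \<alpha>] i(2)
      show "(\<Sum>j\<in>?I. ?\<psi> j i' * ?N j x) = ?L i' x" by (simp add: atMost_atLeast0)
    qed
    finally show ?thesis using orth[OF i] by auto
  qed
  have D_eq: "?D j x = (\<Sum>i\<in>?I. ?\<rho> j i * ?L i x)" for j x
    by (simp add: dual_fun_def atMost_atLeast0)
  \<comment> \<open>The inverse of the relation that defines the dual functions.\<close>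
  have L_eq: "?L i x = (\<Sum>j\<in>?I. inner_L (?N j) (?L i) * ?D j x)" if i: "i \<in> ?I" for i x
  proof -
    have "(\<Sum>j\<in>?I. inner_L (?N j) (?L i) * ?D j x)
        = (\<Sum>j\<in>?I. \<Sum>i'\<in>?I. ?\<psi> j i' * inner_L (?N j) (?L i) * (?L i' x / inner_L (?L i') (?L i')))"
      unfolding D_eq sum_distrib_left rho_def by (simp add: field_simps)
    also have "\<dots> = (\<Sum>i'\<in>?I. (\<Sum>j\<in>?I. ?\<psi> j i' * inner_L (?N j) (?L i)) * (?L i' x / inner_L (?L i') (?L i')))"
      unfolding sum_distrib_right by (rule sum.swap)
    also have "\<dots> = (\<Sum>i'\<in>?I. if i = i' then ?L i x else 0)"
    proof (rule sum.cong[OF refl])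
      fix i' assume i': "i' \<in> ?I"
      show "(\<Sum>j\<in>?I. ?\<psi> j i' * inner_L (?N j) (?L i)) * (?L i' x / inner_L (?L i') (?L i'))
          = (if i = i' then ?L i x else 0)"
        unfolding gram[OF i i'] using norm[OF i] by auto
    qed
    also have "\<dots> = ?L i x" using i by simp
    finally show ?thesis ..
  qed
  have D_basis: "basis_family ?D ?I (spline_space t n m)"
  proof (rule basis_family_change[OF L_basis finite_atLeastAtMost])
    show "?D j = (\<Sum>i\<in>?I. fscale (?\<rho> j i) (?L i))" for j
      by (rule ext) (simp only: sum_fscale_apply D_eq)
    show "?L i = (\<Sum>j\<in>?I. fscale (inner_L (?N j) (?L i)) (?D j))" if "i \<in> ?I" for i
      by (rule ext) (simp only: sum_fscale_apply L_eq[OF that, symmetric])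
  qed
  moreover have "inner_L (?N h) (?D j) = (if h = j then 1 else 0)"
    if h: "h \<in> ?I" and j: "j \<in> ?I" for h j
  proof -
    \<comment> \<open>Both sides expand D j in the basis D; the inner sum on the left is the inner product of
      N h with D j.\<close>
    have "(\<Sum>h\<in>?I. (\<Sum>i\<in>?I. ?\<rho> j i * inner_L (?N h) (?L i)) * ?D h x)
        = (\<Sum>h\<in>?I. (if h = j then 1 else 0) * ?D h x)" for x
    proof -
      have "(\<Sum>h\<in>?I. (\<Sum>i\<in>?I. ?\<rho> j i * inner_L (?N h) (?L i)) * ?D h x)
          = (\<Sum>i\<in>?I. \<Sum>h\<in>?I. ?\<rho> j i * inner_L (?N h) (?L i) * ?D h x)"
        unfolding sum_distrib_right by (rule sum.swap)
      also have "\<dots> = (\<Sum>i\<in>?I. ?\<rho> j i * ?L i x)"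
        by (intro sum.cong refl)
          (simp only: L_eq[symmetric] mult.assoc sum_distrib_left[symmetric])
      also have "\<dots> = ?D j x" by (rule D_eq[symmetric])
      also have "\<dots> = (\<Sum>h\<in>?I. (if h = j then 1 else 0) * ?D h x)"
      proof -
        have "(\<Sum>h\<in>?I. (if h = j then 1 else 0) * ?D h x) = (\<Sum>h\<in>?I. if h = j then ?D h x else 0)"
          by (intro sum.cong) auto
        then show ?thesis using j by simp
      qed
      finally show ?thesis .
    qed
    then have "(\<Sum>i\<in>?I. ?\<rho> j i * inner_L (?N h) (?L i)) = (if h = j then 1 else 0)"
      by (rule basis_family_coeffs_eq[OF D_basis finite_atLeastAtMost _ h])
    moreover have "?D j = (\<lambda>x. \<Sum>i\<in>?I. ?\<rho> j i * ?L i x)" by (rule ext) (rule D_eq)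
    ultimately show ?thesis
      using inner_L_sum_right[OF piecewise_poly_bspline L_pp finite_atLeastAtMost,
          of 0 "n + m" "\<lambda>i. i" n "- int n + int h" "?\<rho> j"]
      by simp
  qed
  ultimately show ?thesis by auto
qed

end
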